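(* Let $1\le p<2$. There is no separable Banach space which is complementably universal for the family of all (closed) subspaces of $\ell_p$.
   Context: A Banach space $W$ is complementably universal for a family $\mathcal A$ of Banach spaces if every space in $\mathcal A$ is isomorphic to a complemented subspace of $W$. *)

theory Defs
  imports "HOL-Analysis.Analysis" "HOL-Library.Function_Algebras"
begin

instantiation "fun" :: (type, real_vector) real_vector
begin

definition scaleR_fun_def: "c *\<^sub>R f = (\<lambda>x. c *\<^sub>R f x)"

instance
  by standard (simp_all add: scaleR_fun_def fun_eq_iff algebra_simps)

end

lemma scaleR_fun_apply [simp]: "(c *\<^sub>R f) x = c *\<^sub>R f x"
  by (simp add: scaleR_fun_def)

text \<open>
  A normed space need not live on a whole type here: it is given by a linear subspace \<open>X\<close> of
  a real vector space together with a function \<open>nrm\<close> whose restriction to \<open>X\<close> is a norm.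
\<close>

definition isomorphic_normed ::
    "'a::real_vector set \<Rightarrow> ('a \<Rightarrow> real) \<Rightarrow> 'b::real_vector set \<Rightarrow> ('b \<Rightarrow> real) \<Rightarrow> bool" where
  "isomorphic_normed X nrmX Y nrmY \<longleftrightarrow>
     (\<exists>T. bij_betw T X Y \<and>
          (\<forall>x\<in>X. \<forall>y\<in>X. T (x + y) = T x + T y) \<and>
          (\<forall>c. \<forall>x\<in>X. T (c *\<^sub>R x) = c *\<^sub>R T x) \<and>
          (\<exists>C. \<forall>x\<in>X. nrmY (T x) \<le> C * nrmX x) \<and>
          (\<exists>C. \<forall>x\<in>X. nrmX x \<le> C * nrmY (T x)))"

text \<open>The range of a bounded projection is automatically a closed linear subspace.\<close>

definition complemented_subspace :: "'w::real_normed_vector set \<Rightarrow> bool" where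
  "complemented_subspace V \<longleftrightarrow> (\<exists>P. bounded_linear P \<and> P \<circ> P = P \<and> range P = V)"

definition complementably_universal ::
    "'w::banach itself \<Rightarrow> ('a::real_vector set \<times> ('a \<Rightarrow> real)) set \<Rightarrow> bool" where
  "complementably_universal (_ :: 'w itself) \<A> \<longleftrightarrow>
     (\<forall>(X, nrm)\<in>\<A>. \<exists>V :: 'w set. complemented_subspace V \<and> isomorphic_normed X nrm V norm)"

definition lp :: "real \<Rightarrow> (nat \<Rightarrow> real) set" where
  "lp p = {x. summable (\<lambda>n. \<bar>x n\<bar> powr p)}"

definition lp_norm :: "real \<Rightarrow> (nat \<Rightarrow> real) \<Rightarrow> real" where
  "lp_norm p x = (\<Sum>n. \<bar>x n\<bar> powr p) powr (1 / p)"

text \<open>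
  The metric topology is defined inside a locale and hence only meaningful once \<open>lp p\<close> is
  known to be a metric space; see \<open>Metric_space_lp\<close> below.
\<close>

definition lp_topology :: "real \<Rightarrow> (nat \<Rightarrow> real) topology" where
  "lp_topology p = Metric_space.mtopology (lp p) (\<lambda>x y. lp_norm p (x - y))"

definition closed_subspaces_lp :: "real \<Rightarrow> ((nat \<Rightarrow> real) set \<times> ((nat \<Rightarrow> real) \<Rightarrow> real)) set" where
  "closed_subspaces_lp p = {(X, lp_norm p) | X. subspace X \<and> closedin (lp_topology p) X}"

lemma powr_convex_aux:
  fixes a b A B p :: real
  assumes "p \<ge> 1" "a \<ge> 0" "b \<ge> 0" "A > 0" "B > 0"
  shows "((a + b) / (A + B)) powr p
           \<le> A / (A + B) * (a / A) powr p + B / (A + B) * (b / B) powr p"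
proof -
  have zero: "(b / (A + B)) powr p \<le> B / (A + B) * (b / B) powr p"
    if "b \<ge> 0" "A > 0" "B > 0" for b A B :: real
  proof -
    have "b / (A + B) = (B / (A + B)) * (b / B)"
      using that by simp
    hence "(b / (A + B)) powr p = (B / (A + B)) powr p * (b / B) powr p"
      using that by (metis powr_mult)
    also have "(B / (A + B)) powr p \<le> (B / (A + B)) powr 1"
      using that assms(1) by (intro powr_mono') auto
    hence "(B / (A + B)) powr p * (b / B) powr p \<le> B / (A + B) * (b / B) powr p"
      using that by (intro mult_right_mono) auto
    finally show ?thesis .
  qed
  consider "a = 0" | "b = 0" | "a > 0" "b > 0"
    using assms by linarith
  thus ?thesis
  proof cases
    case 1
    thus ?thesis using zero[of b A B] assms by simp
  next
    case 2
    thus ?thesis using zero[of a B A] assms by (simp add: add.commute)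
  next
    case 3
    have sum1: "A / (A + B) + B / (A + B) = 1"
      using assms by (simp flip: add_divide_distrib)
    have "((A / (A + B)) *\<^sub>R (a / A) + (B / (A + B)) *\<^sub>R (b / B)) powr p
            \<le> A / (A + B) * (a / A) powr p + B / (A + B) * (b / B) powr p"
      using powr_convex[OF assms(1), unfolded convex_on_def, THEN conjunct2, rule_format,
          of "a / A" "b / B" "A / (A + B)" "B / (A + B)"] sum1 3 assms
      by simp
    moreover have "(A / (A + B)) *\<^sub>R (a / A) + (B / (A + B)) *\<^sub>R (b / B) = (a + b) / (A + B)"
      using assms by (simp add: add_divide_distrib)
    ultimately show ?thesis by simp
  qed
qed

lemma lp_norm_nonneg [simp]: "lp_norm p x \<ge> 0"
  by (simp add: lp_norm_def)

lemma lp_norm_zero [simp]: "p \<ge> 1 \<Longrightarrow> lp_norm p 0 = 0"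
  by (simp add: lp_norm_def)

lemma lp_norm_minus [simp]: "lp_norm p (- x) = lp_norm p x"
  by (simp add: lp_norm_def fun_Compl_def)

lemma lp_norm_powr: "p \<ge> 1 \<Longrightarrow> x \<in> lp p \<Longrightarrow> lp_norm p x powr p = (\<Sum>n. \<bar>x n\<bar> powr p)"
  by (simp add: lp_norm_def lp_def powr_powr suminf_nonneg)

lemma lp_norm_eq_0:
  assumes "p \<ge> 1" "x \<in> lp p"
  shows "lp_norm p x = 0 \<longleftrightarrow> x = 0"
proof
  assume "lp_norm p x = 0"
  hence "(\<Sum>n. \<bar>x n\<bar> powr p) = 0"
    using lp_norm_powr[OF assms] assms by simp
  hence "\<forall>n. \<bar>x n\<bar> powr p = 0"
    using assms by (subst (asm) suminf_eq_zero_iff) (auto simp: lp_def)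
  thus "x = 0" by (simp add: fun_eq_iff)
qed (use assms in simp)

lemma lp_add:
  assumes "p \<ge> 1" "x \<in> lp p" "y \<in> lp p"
  shows "x + y \<in> lp p"
proof -
  have bound: "\<bar>(x + y) n\<bar> powr p \<le> 2 powr p * (\<bar>x n\<bar> powr p + \<bar>y n\<bar> powr p)" for n
  proof -
    have "\<bar>(x + y) n\<bar> powr p \<le> (2 * ((\<bar>x n\<bar> + \<bar>y n\<bar>) / 2)) powr p"
      using assms abs_triangle_ineq[of "x n" "y n"] by (intro powr_mono2) (auto simp: algebra_simps)
    also have "\<dots> = 2 powr p * ((\<bar>x n\<bar> + \<bar>y n\<bar>) / 2) powr p"
      by (simp only: powr_mult)
    also have "((\<bar>x n\<bar> + \<bar>y n\<bar>) / 2) powr p \<le> \<bar>x n\<bar> powr p + \<bar>y n\<bar> powr p"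
    proof -
      have "((\<bar>x n\<bar> + \<bar>y n\<bar>) / 2) powr p \<le> \<bar>x n\<bar> powr p / 2 + \<bar>y n\<bar> powr p / 2"
        using powr_convex_aux[OF assms(1), of "\<bar>x n\<bar>" "\<bar>y n\<bar>" 1 1] by simp
      thus ?thesis
        using powr_ge_zero[of "\<bar>x n\<bar>" p] powr_ge_zero[of "\<bar>y n\<bar>" p] by linarith
    qed
    finally show ?thesis by (simp add: mult_left_mono)
  qed
  have summ: "summable (\<lambda>n. 2 powr p * (\<bar>x n\<bar> powr p + \<bar>y n\<bar> powr p))"
    using assms by (intro summable_mult summable_add) (auto simp: lp_def)
  have "summable (\<lambda>n. \<bar>(x + y) n\<bar> powr p)"
  proof (rule summable_comparison_test'[OF summ])
    show "norm (\<bar>(x + y) n\<bar> powr p) \<le> 2 powr p * (\<bar>x n\<bar> powr p + \<bar>y n\<bar> powr p)" if "n \<ge> 0" for n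
      using bound[of n] by (simp only: real_norm_def abs_of_nonneg powr_ge_zero)
  qed
  thus ?thesis
    by (simp add: lp_def)
qed

lemma lp_scaleR:
  assumes "x \<in> lp p"
  shows "c *\<^sub>R x \<in> lp p"
  using assms by (simp add: lp_def abs_mult powr_mult summable_mult)

lemma subspace_lp: "p \<ge> 1 \<Longrightarrow> subspace (lp p)"
  by (intro subspaceI lp_add lp_scaleR) (auto simp: lp_def)

lemma lp_norm_scaleR:
  assumes "p \<ge> 1" "x \<in> lp p"
  shows "lp_norm p (c *\<^sub>R x) = \<bar>c\<bar> * lp_norm p x"
  using assms
  by (simp add: lp_norm_def lp_def abs_mult powr_mult suminf_mult powr_powr suminf_nonneg)

lemma lp_norm_triangle:
  assumes "p \<ge> 1" "x \<in> lp p" "y \<in> lp p"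
  shows "lp_norm p (x + y) \<le> lp_norm p x + lp_norm p y"
proof -
  define A B where "A = lp_norm p x" and "B = lp_norm p y"
  consider "A = 0" | "B = 0" | "A > 0" "B > 0"
    using lp_norm_nonneg[of p x] lp_norm_nonneg[of p y] unfolding A_def B_def by linarith
  thus ?thesis
  proof cases
    case 1
    thus ?thesis using lp_norm_eq_0[of p x] assms A_def by simp
  next
    case 2
    thus ?thesis using lp_norm_eq_0[of p y] assms B_def by simp
  next
    case 3
    let ?f = "\<lambda>n. A / (A + B) * (\<bar>x n\<bar> powr p / A powr p) + B / (A + B) * (\<bar>y n\<bar> powr p / B powr p)"
    have sx: "(\<lambda>n. \<bar>x n\<bar> powr p) sums (A powr p)"
      using lp_norm_powr[OF assms(1,2)] assms(2) by (simp add: A_def lp_def summable_sums)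
    have sy: "(\<lambda>n. \<bar>y n\<bar> powr p) sums (B powr p)"
      using lp_norm_powr[OF assms(1,3)] assms(3) by (simp add: B_def lp_def summable_sums)
    have "?f sums (A / (A + B) * (A powr p / A powr p) + B / (A + B) * (B powr p / B powr p))"
      by (intro sums_add sums_mult sums_divide sx sy)
    moreover have "A / (A + B) * (A powr p / A powr p) + B / (A + B) * (B powr p / B powr p) = 1"
      using 3 by (simp add: add_divide_distrib [symmetric])
    ultimately have f: "?f sums 1" by simp
    have le: "\<bar>(x + y) n\<bar> powr p \<le> (A + B) powr p * ?f n" for n
    proof -
      have "\<bar>(x + y) n\<bar> powr p \<le> ((A + B) * ((\<bar>x n\<bar> + \<bar>y n\<bar>) / (A + B))) powr p"
        using assms 3 abs_triangle_ineq[of "x n" "y n"] by (intro powr_mono2) auto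
      also have "\<dots> = (A + B) powr p * ((\<bar>x n\<bar> + \<bar>y n\<bar>) / (A + B)) powr p"
        by (simp only: powr_mult)
      also have "((\<bar>x n\<bar> + \<bar>y n\<bar>) / (A + B)) powr p \<le> ?f n"
        using powr_convex_aux[OF assms(1), of "\<bar>x n\<bar>" "\<bar>y n\<bar>" A B] 3
        by (simp add: powr_divide)
      finally show ?thesis by (simp add: mult_left_mono)
    qed
    have g: "(\<lambda>n. (A + B) powr p * ?f n) sums ((A + B) powr p)"
      using sums_mult[OF f, of "(A + B) powr p"] by simp
    have "lp_norm p (x + y) powr p \<le> (A + B) powr p"
      using sums_le[OF le summable_sums g] lp_add[OF assms] lp_norm_powr[OF assms(1) lp_add[OF assms]]
      by (simp add: lp_def)
    hence "lp_norm p (x + y) \<le> A + B"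
      using 3 assms(1) powr_less_mono2[of p "A + B" "lp_norm p (x + y)"] by linarith
    thus ?thesis by (simp add: A_def B_def)
  qed
qed

lemma Metric_space_lp:
  assumes "p \<ge> 1"
  shows "Metric_space (lp p) (\<lambda>x y. lp_norm p (x - y))"
proof
  fix x y z :: "nat \<Rightarrow> real"
  show "0 \<le> lp_norm p (x - y)" by simp
  show "lp_norm p (x - y) = lp_norm p (y - x)"
    by (metis lp_norm_minus minus_diff_eq)
  assume x: "x \<in> lp p" and y: "y \<in> lp p"
  have diff: "u - v \<in> lp p" if "u \<in> lp p" "v \<in> lp p" for u v
    using that subspace_lp[OF assms] by (simp add: subspace_diff)
  show "lp_norm p (x - y) = 0 \<longleftrightarrow> x = y"
    using lp_norm_eq_0[OF assms diff[OF x y]] by simp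
  assume z: "z \<in> lp p"
  show "lp_norm p (x - z) \<le> lp_norm p (x - y) + lp_norm p (y - z)"
    using lp_norm_triangle[OF assms diff[OF x y] diff[OF y z]] by simp
qed

end

theory Submission
  imports Defs "HOL-Library.Nat_Bijection"
begin

text \<open>
  A variant of Szankowski's construction. Finite bit strings (at level \<open>k\<close>, subsets \<open>m\<close> of
  \<open>{..k + 1}\<close>) index vectors \<open>e\<^sub>m\<close> in \<open>\<ell>\<^sub>p\<close> which behave like an \<open>\<ell>\<^sub>2\<close>-basis within a block and like an
  \<open>\<ell>\<^sub>p\<close>-basis across blocks. The vectors \<open>z\<^sub>s\<close> spread over two consecutive levels, and their
  biorthogonal functionals can be read off on either level, so that the averaged trace of an operator
  \<open>T\<close> at level \<open>n + 1\<close> minus the one at level \<open>n\<close> is an average of terms \<open>e\<^sub>m\<^sup>*(T y\<^sub>m)\<close>, where the blocks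
  are arranged so that, along suitable sets \<open>A\<close> of indices, the \<open>y\<^sub>m\<close> satisfy an upper
  \<open>\<ell>\<^sub>2\<close>-estimate and the \<open>e\<^sub>m\<^sup>*\<close> lie in different blocks. Random signs bound the difference by a multiple of
  \<open>|A| powr (1/2 - 1/p)\<close>, which is summable because \<open>p < 2\<close>.

  A set \<open>R\<close> of bit positions is an additional parameter: if \<open>R' - R\<close> is infinite, the same estimate, now
  along the bits in \<open>R' - R\<close>, makes the trace of every operator from the space of \<open>R\<close> to the space of
  \<open>R'\<close> tend to \<open>0\<close>. Take \<open>R\<^sub>x\<close> to be coded by the rationals below the real \<open>x\<close>. If all these spaces were
  complemented in one separable space \<open>W\<close>, then for some \<open>x < y\<close> the embeddings into \<open>W\<close> would nearly
  agree on the finitely many \<open>z\<^sub>s\<close> of a high level \<open>N\<close>; the operator that passes through \<open>W\<close> then has trace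
  close to \<open>1\<close> at level \<open>N\<close>, hence at all higher levels, a contradiction.
\<close>

section \<open>Walsh functions and coordinate vectors in \<open>\<ell>\<^sub>p\<close>\<close>

text \<open>Jensen's inequality for uniform weights. Adding one point is a two-point convexity step
  with weights \<open>card S\<close> and \<open>1\<close>.\<close>

lemma power_mean:
  fixes f :: "'a \<Rightarrow> real"
  assumes "finite S" "S \<noteq> {}" "\<And>i. i \<in> S \<Longrightarrow> f i \<ge> 0" "q \<ge> 1"
  shows "(sum f S / card S) powr q \<le> (\<Sum>i\<in>S. f i powr q) / card S"
  using assms(1-3)
proof (induction S rule: finite_ne_induct)
  case (insert x S)
  have c: "real (card S) > 0"
    using insert by (simp add: card_gt_0_iff)
  have "((sum f S + f x) / (real (card S) + 1)) powr q
      \<le> card S / (real (card S) + 1) * (sum f S / card S) powr q + 1 / (real (card S) + 1) * (f x / 1) powr q"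
    by (rule powr_convex_aux) (use insert c assms(4) in \<open>auto intro: sum_nonneg\<close>)
  also have "\<dots> \<le> card S / (real (card S) + 1) * ((\<Sum>i\<in>S. f i powr q) / card S)
      + 1 / (real (card S) + 1) * (f x / 1) powr q"
    using insert by (intro add_right_mono mult_left_mono) auto
  also have "\<dots> = (\<Sum>i\<in>insert x S. f i powr q) / card (insert x S)"
    using insert c by (simp add: add.commute flip: add_divide_distrib)
  finally show ?case
    using insert by (simp add: add.commute)
qed simp

text \<open>For finite \<open>w\<close> the value is \<open>(-1) ^ card (s \<inter> w)\<close>, a
  character of the group of finite sets under symmetric difference.\<close>

definition walsh :: "nat set \<Rightarrow> nat set \<Rightarrow> real" where
  "walsh s w = (\<Prod>i\<in>w. if i \<in> s then -1 else 1)"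

lemma abs_walsh [simp]: "\<bar>walsh s w\<bar> = 1"
  by (auto simp: walsh_def abs_prod intro!: prod.neutral)

text \<open>Expanding \<open>\<Prod>i\<in>U. f i + 1\<close> over subsets turns the sum into a
  product, and an \<open>i\<close> in exactly one of \<open>s\<close> and \<open>t\<close> gives a
  zero factor.\<close>

lemma walsh_orthogonal:
  assumes "finite U" "s \<subseteq> U" "t \<subseteq> U"
  shows "(\<Sum>w\<in>Pow U. walsh s w * walsh t w) = (if s = t then 2 ^ card U else 0)"
proof -
  define f :: "nat \<Rightarrow> real" where
    "f i = (if i \<in> s then -1 else 1) * (if i \<in> t then -1 else 1)" for i
  have "(\<Sum>w\<in>Pow U. walsh s w * walsh t w) = (\<Sum>w\<in>Pow U. prod f w * prod (\<lambda>_. 1) (U - w))"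
    by (simp add: walsh_def f_def prod.distrib)
  also have "\<dots> = (\<Prod>i\<in>U. f i + 1)"
    by (rule prod_add[symmetric]) (rule assms)
  also have "\<dots> = (if s = t then 2 ^ card U else 0)"
  proof (cases "s = t")
    case True
    hence "f i + 1 = 2" for i
      by (simp add: f_def)
    thus ?thesis
      using True by simp
  next
    case False
    then obtain i where i: "i \<in> U" "(i \<in> s) \<noteq> (i \<in> t)"
      using assms by blast
    hence "f i + 1 = 0"
      by (auto simp: f_def)
    thus ?thesis
      using False i assms by (auto intro!: prod_zero)
  qed
  finally show ?thesis .
qed

lemma walsh_orthogonal':
  assumes "finite V" "s \<subseteq> V" "t \<subseteq> V"
  shows "(\<Sum>w\<in>Pow V. walsh w s * walsh w t) = (if s = t then 2 ^ card V else 0)"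
proof -
  have fin: "finite s" "finite t"
    using assms finite_subset by auto
  have "walsh w s = walsh s w" if "finite s" "finite w" for w s
  proof -
    have "walsh w s = (\<Prod>i\<in>s \<inter> w. -1)" "walsh s w = (\<Prod>i\<in>w \<inter> s. -1)"
      using that by (auto simp: walsh_def prod.If_cases)
    thus ?thesis by (simp add: Int_commute)
  qed
  hence "(\<Sum>w\<in>Pow V. walsh w s * walsh w t) = (\<Sum>w\<in>Pow V. walsh s w * walsh t w)"
    using fin assms(1) by (intro sum.cong) (auto simp: finite_subset)
  thus ?thesis
    using walsh_orthogonal[OF assms] by simp
qed

text \<open>Parseval's identity: orthogonality removes all mixed terms of the expanded
  square.\<close>

lemma sum_walsh_linear_square:
  assumes "finite U" "finite A" "inj_on g A" "\<And>a. a \<in> A \<Longrightarrow> g a \<subseteq> U"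
  shows "(\<Sum>w\<in>Pow U. (\<Sum>a\<in>A. \<theta> a * walsh (g a) w)\<^sup>2) = 2 ^ card U * (\<Sum>a\<in>A. (\<theta> a)\<^sup>2)"
proof -
  have "(\<Sum>w\<in>Pow U. (\<Sum>a\<in>A. \<theta> a * walsh (g a) w)\<^sup>2)
      = (\<Sum>w\<in>Pow U. \<Sum>a\<in>A. \<Sum>b\<in>A. \<theta> a * \<theta> b * (walsh (g a) w * walsh (g b) w))"
    by (simp add: power2_eq_square sum_product algebra_simps)
  also have "\<dots> = (\<Sum>a\<in>A. \<Sum>b\<in>A. \<theta> a * \<theta> b * (\<Sum>w\<in>Pow U. walsh (g a) w * walsh (g b) w))"
    by (simp add: sum.swap[of _ _ "Pow U"] sum_distrib_left)
  also have "\<dots> = (\<Sum>a\<in>A. \<Sum>b\<in>A. if a = b then \<theta> a * \<theta> b * 2 ^ card U else 0)"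
    using assms by (intro sum.cong refl) (auto simp: walsh_orthogonal inj_on_eq_iff)
  also have "\<dots> = 2 ^ card U * (\<Sum>a\<in>A. (\<theta> a)\<^sup>2)"
    using assms by (simp add: power2_eq_square sum_distrib_left mult.commute)
  finally show ?thesis .
qed

text \<open>
  Averaging over the characters of the group of subsets of \<open>V\<close> isolates the diagonal of a matrix;
  they play the role of random signs.
\<close>

lemma diagonal_le_walsh_average:
  assumes "finite V"
    and bound: "\<And>w. w \<subseteq> V \<Longrightarrow>
      (\<Sum>u\<in>Pow V. \<bar>\<Sum>v\<in>Pow V. walsh w v * \<psi> u v\<bar>) \<le> (C::real)"
  shows "\<bar>\<Sum>u\<in>Pow V. \<psi> u u\<bar> \<le> C"
proof -
  have "(\<Sum>w\<in>Pow V. \<Sum>u\<in>Pow V. walsh w u * (\<Sum>v\<in>Pow V. walsh w v * \<psi> u v))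
      = (\<Sum>u\<in>Pow V. \<Sum>v\<in>Pow V. (\<Sum>w\<in>Pow V. walsh w u * walsh w v) * \<psi> u v)"
    unfolding sum_distrib_left sum_distrib_right
    by (subst sum.swap, rule sum.cong[OF refl], subst sum.swap) (simp add: mult.assoc)
  also have "\<dots> = (\<Sum>u\<in>Pow V. \<Sum>v\<in>Pow V. if u = v then 2 ^ card V * \<psi> u v else 0)"
    using assms(1) by (intro sum.cong refl) (auto simp: walsh_orthogonal')
  also have "\<dots> = 2 ^ card V * (\<Sum>u\<in>Pow V. \<psi> u u)"
    using assms(1) by (simp add: sum_distrib_left)
  finally have "2 ^ card V * \<bar>\<Sum>u\<in>Pow V. \<psi> u u\<bar>
      = \<bar>\<Sum>w\<in>Pow V. \<Sum>u\<in>Pow V. walsh w u * (\<Sum>v\<in>Pow V. walsh w v * \<psi> u v)\<bar>"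
    by (simp add: abs_mult)
  also have "\<dots> \<le> (\<Sum>w\<in>Pow V. \<Sum>u\<in>Pow V. \<bar>walsh w u * (\<Sum>v\<in>Pow V. walsh w v * \<psi> u v)\<bar>)"
    by (rule order.trans[OF sum_abs], rule sum_mono, rule sum_abs)
  also have "\<dots> \<le> (\<Sum>w\<in>Pow V. C)"
    using bound by (intro sum_mono) (simp only: abs_mult abs_walsh mult_1 Pow_iff)
  also have "\<dots> = 2 ^ card V * C"
    using assms(1) by (simp add: card_Pow)
  finally show ?thesis by simp
qed

section \<open>Block vectors and their dual functionals\<close>

definition pos :: "nat \<Rightarrow> nat \<Rightarrow> nat set \<Rightarrow> nat" where
  "pos n l w = prod_encode (prod_encode (n, l), set_encode w)"

lemma pos_eq_iff:
  assumes "finite w" "finite w'"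
  shows "pos n l w = pos n' l' w' \<longleftrightarrow> n = n' \<and> l = l' \<and> w = w'"
  using assms by (auto simp: pos_def set_encode_eq)

text \<open>A Walsh function on the \<open>2 ^ n\<close> coordinates of block \<open>(n, l)\<close>,
  scaled so that \<open>lp_norm\<close> becomes the Lp norm for the uniform probability measure on
  the block.\<close>

definition bvec :: "real \<Rightarrow> nat \<Rightarrow> nat \<Rightarrow> nat set \<Rightarrow> nat \<Rightarrow> real" where
  "bvec p n l s k = (case prod_decode k of (a, b) \<Rightarrow>
     if a = prod_encode (n, l) \<and> set_decode b \<subseteq> {..<n}
     then walsh s (set_decode b) * (1 / 2 ^ n) powr (1 / p) else 0)"

text \<open>The dual scaling: \<open>1 - 1 / p\<close> is the reciprocal of the conjugate exponent,
  so pairing with \<open>bvec\<close> averages products of Walsh functions.\<close>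

definition bfun :: "real \<Rightarrow> nat \<Rightarrow> nat \<Rightarrow> nat set \<Rightarrow> (nat \<Rightarrow> real) \<Rightarrow> real" where
  "bfun p n l s x = (1 / 2 ^ n) powr (1 - 1 / p) * (\<Sum>w\<in>Pow {..<n}. walsh s w * x (pos n l w))"

lemma bvec_pos:
  "finite w \<Longrightarrow> bvec p n l s (pos n' l' w) =
     (if n = n' \<and> l = l' \<and> w \<subseteq> {..<n} then walsh s w * (1 / 2 ^ n) powr (1 / p) else 0)"
  by (auto simp: bvec_def pos_def)

lemma bvec_outside:
  assumes "k \<notin> pos n l ` Pow {..<n}"
  shows "bvec p n l s k = 0"
proof -
  obtain a b where ab: "prod_decode k = (a, b)"
    by fastforce
  hence "k = prod_encode (a, b)"
    by (metis prod_decode_inverse)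
  hence "k = pos n l (set_decode b)" if "a = prod_encode (n, l)"
    using that by (simp add: pos_def)
  thus ?thesis
    using assms ab by (auto simp: bvec_def)
qed

lemma inj_on_pos: "inj_on (pos n l) (Pow {..<n})"
  by (auto intro!: inj_onI simp: pos_eq_iff finite_subset)

lemma lp_finite_support:
  assumes "finite S" "\<And>k. k \<notin> S \<Longrightarrow> x k = 0"
  shows "x \<in> lp p" "(\<Sum>k. \<bar>x k\<bar> powr p) = (\<Sum>k\<in>S. \<bar>x k\<bar> powr p)"
  unfolding lp_def using assms by (auto intro!: summable_finite suminf_finite)

lemma bvec_in_lp [simp]: "bvec p n l s \<in> lp p"
  by (rule lp_finite_support[where S = "pos n l ` Pow {..<n}"]) (auto intro: bvec_outside)

lemma sum_apply: "(\<Sum>a\<in>A. f a) x = (\<Sum>a\<in>A. f a x)"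
  by (induction A rule: infinite_finite_induct) auto

text \<open>Inside one block the norm is an Lp norm for a probability measure. As
  \<open>p < 2\<close>, it is at most the L2 norm, which Parseval's identity computes.\<close>

lemma lp_norm_sum_bvec:
  assumes p: "1 \<le> p" "p < 2"
    and A: "finite A" "inj_on g A" "\<And>a. a \<in> A \<Longrightarrow> g a \<subseteq> {..<n}"
  shows "lp_norm p (\<Sum>a\<in>A. \<theta> a *\<^sub>R bvec p n l (g a)) \<le> sqrt (\<Sum>a\<in>A. (\<theta> a)\<^sup>2)"
proof -
  define x where "x = (\<Sum>a\<in>A. \<theta> a *\<^sub>R bvec p n l (g a))"
  define f where "f w = (\<Sum>a\<in>A. \<theta> a * walsh (g a) w)" for w
  let ?P = "Pow {..<n}"
  have out: "x k = 0" if "k \<notin> pos n l ` ?P" for k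
    using that by (simp add: x_def sum_apply bvec_outside)
  have x_pos: "x (pos n l w) = f w * (1 / 2 ^ n) powr (1 / p)" if "w \<in> ?P" for w
    using that finite_subset[of w "{..<n}"]
    by (simp add: x_def f_def sum_apply bvec_pos sum_distrib_right mult.assoc)
  have "(\<Sum>k. \<bar>x k\<bar> powr p) = (\<Sum>k\<in>pos n l ` ?P. \<bar>x k\<bar> powr p)"
    by (intro lp_finite_support out) auto
  also have "\<dots> = (\<Sum>w\<in>?P. \<bar>x (pos n l w)\<bar> powr p)"
    by (subst sum.reindex[OF inj_on_pos]) simp
  also have "\<dots> = (\<Sum>w\<in>?P. \<bar>f w\<bar> powr p) / 2 ^ n"
    using p by (simp add: x_pos abs_mult powr_mult powr_powr sum_divide_distrib)
  finally have eq: "(\<Sum>k. \<bar>x k\<bar> powr p) = (\<Sum>w\<in>?P. \<bar>f w\<bar> powr p) / card ?P"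
    by (simp add: card_Pow)
  have "((\<Sum>w\<in>?P. \<bar>f w\<bar> powr p) / card ?P) powr (2 / p)
      \<le> (\<Sum>w\<in>?P. (\<bar>f w\<bar> powr p) powr (2 / p)) / card ?P"
    using p by (intro power_mean) auto
  also have "\<dots> = (\<Sum>w\<in>?P. (f w)\<^sup>2) / 2 ^ n"
    using p by (simp add: powr_powr card_Pow)
  also have "\<dots> = (\<Sum>a\<in>A. (\<theta> a)\<^sup>2)"
    unfolding f_def by (subst sum_walsh_linear_square) (use A in auto)
  finally have "(\<Sum>k. \<bar>x k\<bar> powr p) powr (2 / p) \<le> (\<Sum>a\<in>A. (\<theta> a)\<^sup>2)"
    unfolding eq .
  moreover have "(\<Sum>k. \<bar>x k\<bar> powr p) powr (2 / p) = (lp_norm p x)\<^sup>2"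
    by (simp add: lp_norm_def power2_eq_square flip: powr_add)
  ultimately show ?thesis
    unfolding x_def[symmetric] by (simp add: real_le_rsqrt)
qed

text \<open>Hoelder's inequality against the constant \<open>1\<close> on \<open>K\<close>, obtained
  from the power means.\<close>

lemma lp_finite_sum_abs_le:
  assumes p: "1 \<le> p" and x: "x \<in> lp p" and K: "finite K"
  shows "(\<Sum>k\<in>K. \<bar>x k\<bar>) \<le> real (card K) powr (1 - 1 / p) * lp_norm p x"
proof (cases "K = {}")
  case False
  define c where "c = real (card K)"
  have c: "c > 0"
    using False K by (simp add: c_def card_gt_0_iff)
  have "((\<Sum>k\<in>K. \<bar>x k\<bar>) / c) powr p \<le> (\<Sum>k\<in>K. \<bar>x k\<bar> powr p) / c"
    unfolding c_def using p K False by (intro power_mean) auto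
  also have "\<dots> \<le> (\<Sum>k. \<bar>x k\<bar> powr p) / c"
    using x c K by (intro divide_right_mono sum_le_suminf) (auto simp: lp_def)
  finally have "(((\<Sum>k\<in>K. \<bar>x k\<bar>) / c) powr p) powr (1 / p)
      \<le> ((\<Sum>k. \<bar>x k\<bar> powr p) / c) powr (1 / p)"
    using p by (intro powr_mono2) auto
  hence "(\<Sum>k\<in>K. \<bar>x k\<bar>) / c \<le> lp_norm p x / c powr (1 / p)"
    using p c x by (simp add: powr_powr powr_divide lp_norm_def sum_nonneg suminf_nonneg lp_def)
  hence "(\<Sum>k\<in>K. \<bar>x k\<bar>) \<le> c * (lp_norm p x / c powr (1 / p))"
    using c by (simp add: field_simps)
  thus ?thesis
    using c by (simp add: powr_diff c_def)
qed simp

text \<open>Distinct labels put the functionals on disjoint coordinates,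
  \<open>card A * 2 ^ n\<close> in all. Hoelder's inequality yields a power of that number, whose
  \<open>2 ^ n\<close> part cancels the scaling of \<open>bfun\<close>.\<close>

lemma sum_abs_bfun_le:
  assumes p: "1 \<le> p" and x: "x \<in> lp p"
    and A: "finite A" "inj_on l A"
  shows "(\<Sum>a\<in>A. \<bar>bfun p n (l a) (g a) x\<bar>) \<le> real (card A) powr (1 - 1 / p) * lp_norm p x"
proof -
  let ?P = "Pow {..<n}" and ?c = "(1 / 2 ^ n :: real) powr (1 - 1 / p)"
  let ?pos = "\<lambda>(a, w). pos n (l a) w"
  have inj: "inj_on ?pos (A \<times> ?P)"
    using A by (auto intro!: inj_onI simp: pos_eq_iff finite_subset inj_on_eq_iff)
  have "(\<Sum>a\<in>A. \<bar>bfun p n (l a) (g a) x\<bar>) \<le> (\<Sum>a\<in>A. ?c * (\<Sum>w\<in>?P. \<bar>x (pos n (l a) w)\<bar>))"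
    unfolding bfun_def abs_mult
    by (intro sum_mono mult_mono order.trans[OF sum_abs]) (auto simp: abs_mult sum_nonneg)
  also have "\<dots> = ?c * (\<Sum>k\<in>?pos ` (A \<times> ?P). \<bar>x k\<bar>)"
    by (subst sum.reindex[OF inj]) (simp add: sum.cartesian_product case_prod_unfold sum_distrib_left)
  also have "\<dots> \<le> ?c * (real (card (?pos ` (A \<times> ?P))) powr (1 - 1 / p) * lp_norm p x)"
    using p x A by (intro mult_left_mono lp_finite_sum_abs_le) auto
  also have "card (?pos ` (A \<times> ?P)) = card A * 2 ^ n"
    using inj A by (simp add: card_image card_cartesian_product card_Pow)
  also have "?c * (real (card A * 2 ^ n) powr (1 - 1 / p) * lp_norm p x)
      = ((1 / 2 ^ n) * real (card A * 2 ^ n)) powr (1 - 1 / p) * lp_norm p x"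
    by (simp only: powr_mult mult.assoc)
  also have "(1 / 2 ^ n) * real (card A * 2 ^ n) = card A"
    by simp
  finally show ?thesis .
qed

lemma abs_bfun_le: "1 \<le> p \<Longrightarrow> x \<in> lp p \<Longrightarrow> \<bar>bfun p n l s x\<bar> \<le> lp_norm p x"
  using sum_abs_bfun_le[of p x "{0::nat}" "\<lambda>_. l" n "\<lambda>_. s"] by simp

lemma bfun_add: "bfun p n l s (x + y) = bfun p n l s x + bfun p n l s y"
  by (simp add: bfun_def algebra_simps sum.distrib)

lemma bfun_scaleR: "bfun p n l s (c *\<^sub>R x) = c * bfun p n l s x"
  by (simp add: bfun_def algebra_simps sum_distrib_left)

lemma linear_bfun: "linear (bfun p n l s)"
  by (rule linearI) (simp_all add: bfun_add bfun_scaleR)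

lemma bfun_bvec:
  assumes "1 \<le> p" "s \<subseteq> {..<n}" "s' \<subseteq> {..<n'}"
  shows "bfun p n l s (bvec p n' l' s') = (if n = n' \<and> l = l' \<and> s = s' then 1 else 0)"
proof (cases "n = n' \<and> l = l'")
  case True
  have "bfun p n l s (bvec p n' l' s')
      = (1 / 2 ^ n) powr (1 - 1 / p) * (1 / 2 ^ n) powr (1 / p) * (\<Sum>w\<in>Pow {..<n}. walsh s w * walsh s' w)"
    using True by (auto simp: bfun_def bvec_pos finite_subset sum_distrib_left intro!: sum.cong)
  also have "\<dots> = (1 / 2 ^ n) * (if s = s' then 2 ^ n else 0)"
    using True assms walsh_orthogonal[of "{..<n}" s s'] by (simp flip: powr_add)
  finally show ?thesis
    using True by simp
next
  case False
  thus ?thesis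
    by (auto simp: bfun_def bvec_pos finite_subset intro!: sum.neutral)
qed

section \<open>The subspaces of \<open>\<ell>\<^sub>p\<close>\<close>

lemma sum_Pow_doubleton:
  fixes f :: "'a set \<Rightarrow> 'b::ab_group_add"
  assumes "a \<noteq> b"
  shows "sum f (Pow {a, b}) = f {} + f {a} + f {b} + f {a, b}"
proof -
  have "Pow {a, b} = {{}, {a}, {b}, {a, b}}" by auto
  thus ?thesis using assms by (simp add: add.assoc doubleton_eq_iff)
qed

lemma Un_Int_absorb: "s \<subseteq> A \<Longrightarrow> d \<subseteq> D \<Longrightarrow> D \<inter> A = {} \<Longrightarrow> (s \<union> d) \<inter> A = s"
  by blast

lemma Un_disjoint: "s \<inter> V = {} \<Longrightarrow> d \<subseteq> D \<Longrightarrow> D \<inter> V = {} \<Longrightarrow> (s \<union> d) \<inter> V = {}"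
  by blast

lemma Un_least_trans: "s \<subseteq> A \<Longrightarrow> A \<subseteq> B \<Longrightarrow> d \<subseteq> D \<Longrightarrow> D \<subseteq> B \<Longrightarrow> s \<union> d \<subseteq> B"
  by blast

text \<open>Changing bits inside \<open>V m\<close> does not change \<open>V m\<close>, so
  \<open>M\<close> splits into fibres determined by \<open>m - V m\<close>, and the bounds on the
  fibres add up.\<close>

lemma sum_le_fibrewise:
  fixes g :: "'a set \<Rightarrow> real"
  assumes M: "finite M"
    and V: "\<And>m. m \<in> M \<Longrightarrow> finite (V m)"
    and closed: "\<And>m u. m \<in> M \<Longrightarrow> u \<subseteq> V m \<Longrightarrow> m - V m \<union> u \<in> M \<and> V (m - V m \<union> u) = V m"
    and bound: "\<And>m. m \<in> M \<Longrightarrow> \<bar>\<Sum>u\<in>Pow (V m). g (m - V m \<union> u)\<bar> \<le> C * 2 ^ card (V m)"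
  shows "\<bar>sum g M\<bar> \<le> C * card M"
proof -
  define \<kappa> where "\<kappa> m = m - V m" for m
  have fibre: "\<bar>\<Sum>m | m \<in> M \<and> \<kappa> m = t. g m\<bar> \<le> C * real (card {m \<in> M. \<kappa> m = t})"
    if t: "t \<in> \<kappa> ` M" for t
  proof -
    obtain m0 where m0: "m0 \<in> M" "t = \<kappa> m0"
      using t by blast
    have inj: "inj_on (\<lambda>u. t \<union> u) (Pow (V m0))"
      unfolding inj_on_def m0 \<kappa>_def by blast
    have "{m \<in> M. \<kappa> m = t} = (\<lambda>u. t \<union> u) ` Pow (V m0)"
    proof (intro equalityI subsetI)
      fix m assume "m \<in> {m \<in> M. \<kappa> m = t}"
      hence m: "m \<in> M" "\<kappa> m = t" by auto
      \<comment> \<open>Both sides equal \<open>V t\<close>, by \<open>closed\<close> with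
        \<open>u = {}\<close>.\<close>
      hence "V m = V m0"
        using closed[of m "{}"] closed[of m0 "{}"] m0 by (simp add: \<kappa>_def)
      moreover have "m = t \<union> (m \<inter> V m)"
        using m by (auto simp: \<kappa>_def)
      ultimately show "m \<in> (\<lambda>u. t \<union> u) ` Pow (V m0)" by blast
    next
      fix m assume "m \<in> (\<lambda>u. t \<union> u) ` Pow (V m0)"
      then obtain u where u: "u \<subseteq> V m0" "m = t \<union> u" by blast
      thus "m \<in> {m \<in> M. \<kappa> m = t}"
        using closed[of m0 u] m0 by (auto simp: \<kappa>_def)
    qed
    thus ?thesis
      using bound[OF m0(1)] V[OF m0(1)] inj
      by (simp add: sum.reindex card_image card_Pow m0(2) \<kappa>_def)
  qed
  have "\<bar>sum g M\<bar> = \<bar>\<Sum>t\<in>\<kappa> ` M. \<Sum>m | m \<in> M \<and> \<kappa> m = t. g m\<bar>"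
    using M by (subst sum.group) auto
  also have "\<dots> \<le> (\<Sum>t\<in>\<kappa> ` M. C * real (card {m \<in> M. \<kappa> m = t}))"
    by (rule order.trans[OF sum_abs], rule sum_mono, rule fibre)
  also have "\<dots> = C * real (\<Sum>t\<in>\<kappa> ` M. \<Sum>m | m \<in> M \<and> \<kappa> m = t. 1)"
    by (simp add: sum_distrib_left)
  also have "\<dots> = C * card M"
    using M by (subst sum.group) auto
  finally show ?thesis .
qed

section \<open>Labels and the biorthogonal systems\<close>

definition colour :: "nat \<Rightarrow> nat set \<Rightarrow> nat" where
  "colour k m = 4 * (k mod 2) + (if k \<in> m then 2 else 0) + (if Suc k \<in> m then 1 else 0)"

text \<open>
  Strings of level \<open>k\<close> lie in the same block iff they have the same label. Since the colour depends only on
  the level and the last two bits, changing earlier bits changes the label exactly if a frozen bit is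
  involved. The positions congruent to \<open>8\<close> modulo \<open>9\<close> are not used by any colour and left for \<open>R\<close>.
\<close>

definition frozen :: "nat set \<Rightarrow> nat \<Rightarrow> nat set \<Rightarrow> nat set" where
  "frozen R k m = {i. i mod 9 = colour k m} \<union> R"

definition label :: "nat set \<Rightarrow> nat \<Rightarrow> nat set \<Rightarrow> nat" where
  "label R k m = set_encode (m \<inter> frozen R k m)"

text \<open>Strings of level \<open>k\<close> use the bits up to \<open>Suc k\<close>, which are
  \<open>Suc (Suc k)\<close> bits; this fixes the size of the block.\<close>

definition ev :: "real \<Rightarrow> nat set \<Rightarrow> nat \<Rightarrow> nat set \<Rightarrow> nat \<Rightarrow> real" where
  "ev p R k m = bvec p (Suc (Suc k)) (label R k m) m"

definition ef :: "real \<Rightarrow> nat set \<Rightarrow> nat \<Rightarrow> nat set \<Rightarrow> (nat \<Rightarrow> real) \<Rightarrow> real" where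
  "ef p R k m = bfun p (Suc (Suc k)) (label R k m) m"

definition zv :: "real \<Rightarrow> nat set \<Rightarrow> nat \<Rightarrow> nat set \<Rightarrow> nat \<Rightarrow> real" where
  "zv p R n s = ev p R n s - ev p R n (insert (Suc n) s)
     + (\<Sum>d\<in>Pow {Suc n, Suc (Suc n)}. ev p R (Suc n) (s \<union> d))"

definition zf :: "real \<Rightarrow> nat set \<Rightarrow> nat \<Rightarrow> nat set \<Rightarrow> (nat \<Rightarrow> real) \<Rightarrow> real" where
  "zf p R n s x = (ef p R n s x - ef p R n (insert (Suc n) s) x) / 2"

definition zf' :: "real \<Rightarrow> nat set \<Rightarrow> nat \<Rightarrow> nat set \<Rightarrow> (nat \<Rightarrow> real) \<Rightarrow> real" where
  "zf' p R n s x = (\<Sum>d\<in>Pow {Suc n, Suc (Suc n)}. ef p R (Suc n) (s \<union> d) x) / 4"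

text \<open>
  \<open>zf\<close> and \<open>zf'\<close> are both biorthogonal to \<open>zv\<close>, using different levels. Requiring them to agree gives a
  space that is closed without taking a closure.
\<close>

definition Zspace :: "real \<Rightarrow> nat set \<Rightarrow> (nat \<Rightarrow> real) set" where
  "Zspace p R = {x \<in> lp p. \<forall>n s. s \<subseteq> {..n} \<longrightarrow> zf p R n s x = zf' p R n s x}"

lemma ev_in_lp [simp]: "ev p R k m \<in> lp p"
  by (simp add: ev_def)

lemma linear_ef: "linear (ef p R k m)"
  unfolding ef_def by (rule linear_bfun)

lemma linear_zf: "linear (zf p R n s)"
  by (rule linearI) (simp_all add: zf_def linear_add[OF linear_ef] linear_scale[OF linear_ef]
      field_simps)

lemma linear_zf': "linear (zf' p R n s)"
  by (rule linearI) (simp_all add: zf'_def linear_add[OF linear_ef] linear_scale[OF linear_ef]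
      sum.distrib sum_distrib_left add_divide_distrib)

lemma abs_ef_le: "1 \<le> p \<Longrightarrow> x \<in> lp p \<Longrightarrow> \<bar>ef p R k m x\<bar> \<le> lp_norm p x"
  unfolding ef_def by (rule abs_bfun_le)

lemma abs_zf_le: "1 \<le> p \<Longrightarrow> x \<in> lp p \<Longrightarrow> \<bar>zf p R n s x\<bar> \<le> lp_norm p x"
  using abs_ef_le[of p x R n s] abs_ef_le[of p x R n "insert (Suc n) s"] by (simp add: zf_def)

lemma abs_zf'_le:
  assumes "1 \<le> p" "x \<in> lp p"
  shows "\<bar>zf' p R n s x\<bar> \<le> lp_norm p x"
proof -
  have "\<bar>\<Sum>d\<in>Pow {Suc n, Suc (Suc n)}. ef p R (Suc n) (s \<union> d) x\<bar>
      \<le> (\<Sum>d\<in>Pow {Suc n, Suc (Suc n)}. lp_norm p x)"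
    by (rule order.trans[OF sum_abs], rule sum_mono, rule abs_ef_le[OF assms])
  thus ?thesis by (simp add: zf'_def card_Pow)
qed

lemma ef_ev:
  assumes "1 \<le> p" "m \<subseteq> {..Suc k}" "m' \<subseteq> {..Suc k'}"
  shows "ef p R k m (ev p R k' m') = (if k = k' \<and> m = m' then 1 else 0)"
  using assms by (auto simp: ef_def ev_def bfun_bvec simp flip: lessThan_Suc_atMost)

lemma ef_zv:
  assumes p: "1 \<le> p" and m: "m \<subseteq> {..Suc k}" and s: "s \<subseteq> {..n}"
  shows "ef p R k m (zv p R n s) =
    (if k = n then (if m = s then 1 else 0) - (if m = insert (Suc n) s then 1 else 0) else 0)
    + (if k = Suc n \<and> m \<inter> {..n} = s then 1 else 0)"
proof -
  let ?D = "{Suc n, Suc (Suc n)}"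
  have "ef p R k m (\<Sum>d\<in>Pow ?D. ev p R (Suc n) (s \<union> d))
      = (\<Sum>d\<in>Pow ?D. if k = Suc n \<and> m = s \<union> d then 1 else 0)"
    unfolding linear_sum[OF linear_ef]
    by (intro sum.cong refl ef_ev p m) (use s in fastforce)
  also have "\<dots> = (\<Sum>d\<in>Pow ?D. if m \<inter> ?D = d then if k = Suc n \<and> m \<inter> {..n} = s then 1 else 0 else 0)"
  proof (intro sum.cong refl)
    fix d assume d: "d \<in> Pow ?D"
    have "m = s \<union> d \<longleftrightarrow> m \<inter> ?D = d \<and> m \<inter> {..n} = s" if "k = Suc n"
    proof
      assume "m = s \<union> d"
      moreover have "s \<inter> ?D = {}" "d \<inter> {..n} = {}"
        using s d by fastforce+
      ultimately show "m \<inter> ?D = d \<and> m \<inter> {..n} = s"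
        using d s by blast
    next
      assume "m \<inter> ?D = d \<and> m \<inter> {..n} = s"
      moreover have "m \<subseteq> ?D \<union> {..n}"
        using m that by (fastforce simp: le_Suc_eq)
      ultimately show "m = s \<union> d" by blast
    qed
    thus "(if k = Suc n \<and> m = s \<union> d then 1 else 0 :: real)
        = (if m \<inter> ?D = d then if k = Suc n \<and> m \<inter> {..n} = s then 1 else 0 else 0)"
      by auto
  qed
  also have "\<dots> = (if k = Suc n \<and> m \<inter> {..n} = s then 1 else 0)"
    by (subst sum.delta') auto
  finally have sum: "ef p R k m (\<Sum>d\<in>Pow ?D. ev p R (Suc n) (s \<union> d))
    = (if k = Suc n \<and> m \<inter> {..n} = s then 1 else 0)" .
  have "s \<subseteq> {..Suc n}" "insert (Suc n) s \<subseteq> {..Suc n}"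
    using s by fastforce+
  thus ?thesis
    unfolding zv_def linear_add[OF linear_ef] linear_diff[OF linear_ef] sum
    using p m by (simp add: ef_ev)
qed

text \<open>In level \<open>n\<close>, a vector \<open>zv\<close> of the preceding level has equal
  coefficients at \<open>s\<close> and \<open>insert (Suc n) s\<close>, so the difference in
  \<open>zf\<close> removes it.\<close>

lemma zf_zv:
  assumes p: "1 \<le> p" and s: "s \<subseteq> {..n}" "s' \<subseteq> {..n'}"
  shows "zf p R n s (zv p R n' s') = (if n = n' \<and> s = s' then 1 else 0)"
proof -
  have sub: "s \<subseteq> {..Suc n}" "insert (Suc n) s \<subseteq> {..Suc n}"
    using s by fastforce+
  have "Suc n \<notin> s" "n = n' \<Longrightarrow> Suc n \<notin> s'"
    using s by auto
  moreover from this have "insert (Suc n) s = insert (Suc n) s' \<longleftrightarrow> s = s'" if "n = n'"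
    using that by (metis insert_ident)
  ultimately show ?thesis
    using p s(2) sub by (auto simp: zf_def ef_zv)
qed

text \<open>A vector \<open>zv p R (Suc n) s'\<close> enters level \<open>Suc n\<close> with
  opposite signs at two strings that differ in the bit \<open>Suc (Suc n)\<close>; summing over
  \<open>d\<close> cancels them.\<close>

lemma zf'_zv:
  assumes p: "1 \<le> p" and s: "s \<subseteq> {..n}" "s' \<subseteq> {..n'}"
  shows "zf' p R n s (zv p R n' s') = (if n = n' \<and> s = s' then 1 else 0)"
proof -
  let ?D = "{Suc n, Suc (Suc n)}"
  have D: "?D \<subseteq> {..Suc (Suc n)}" "?D \<inter> {..n} = {}" and mono: "{..n} \<subseteq> {..Suc (Suc n)}"
    by auto
  have sub: "s \<union> d \<subseteq> {..Suc (Suc n)}" if "d \<in> Pow ?D" for d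
    by (rule Un_least_trans[OF s(1) mono PowD[OF that] D(1)])
  have notin: "Suc n \<notin> s" "Suc (Suc n) \<notin> s" "Suc (Suc (Suc n)) \<notin> s"
    using s by auto
  have "(\<Sum>d\<in>Pow ?D. ef p R (Suc n) (s \<union> d) (zv p R n' s')) = (if n = n' \<and> s = s' then 4 else 0)"
  proof -
    consider "n' = n" | "n' = Suc n" | "n' \<noteq> n" "n' \<noteq> Suc n" by blast
    thus ?thesis
    proof cases
      case 1
      have "(s \<union> d) \<inter> {..n} = s" if "d \<in> Pow ?D" for d
        by (rule Un_Int_absorb[OF s(1) PowD[OF that] D(2)])
      hence "(\<Sum>d\<in>Pow ?D. ef p R (Suc n) (s \<union> d) (zv p R n' s'))
          = (\<Sum>d\<in>Pow ?D. if s = s' then 1 else 0)"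
        using 1 p s(2) sub by (intro sum.cong) (auto simp: ef_zv)
      thus ?thesis using 1 by (simp add: card_Pow)
    next
      case 2
      have ne: "A \<noteq> B" "B \<noteq> A" if "Suc (Suc n) \<in> A" "Suc (Suc n) \<notin> B" for A B
        using that by blast+
      have "Suc (Suc n) \<notin> s'"
        using s 2 by auto
      moreover have "s \<union> {Suc (Suc n)} = insert (Suc (Suc n)) s' \<longleftrightarrow> s = s'"
        "s \<union> {Suc n, Suc (Suc n)} = insert (Suc (Suc n)) s' \<longleftrightarrow> insert (Suc n) s = s'"
        using calculation notin by (auto simp: insert_ident)
      moreover have "s \<noteq> insert (Suc (Suc n)) s'" "insert (Suc n) s \<noteq> insert (Suc (Suc n)) s'"
        "insert (Suc (Suc n)) s \<noteq> s'" "insert (Suc n) (insert (Suc (Suc n)) s) \<noteq> s'"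
        using ne[of "insert (Suc (Suc n)) s'"] ne[of _ s'] calculation(1) notin by simp_all
      moreover have "s \<subseteq> {..Suc (Suc n)}"
        using s by fastforce
      ultimately show ?thesis
        using 2 p s(2) unfolding sum_Pow_doubleton[OF n_not_Suc_n]
        by (simp add: ef_zv)
    next
      case 3
      thus ?thesis
        using p s(2) sub by (auto simp: ef_zv intro!: sum.neutral)
    qed
  qed
  thus ?thesis
    by (simp add: zf'_def)
qed

lemma zv_in_lp: "1 \<le> p \<Longrightarrow> zv p R n s \<in> lp p"
  unfolding zv_def
  by (intro subspace_add subspace_diff subspace_sum subspace_lp ev_in_lp)

lemma zv_in_Zspace: "1 \<le> p \<Longrightarrow> s \<subseteq> {..n} \<Longrightarrow> zv p R n s \<in> Zspace p R"
  by (auto simp: Zspace_def zv_in_lp zf_zv zf'_zv)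

lemma Zspace_subset_lp: "Zspace p R \<subseteq> lp p"
  by (auto simp: Zspace_def)

lemma subspace_Zspace: "1 \<le> p \<Longrightarrow> subspace (Zspace p R)"
  using subspace_lp[of p]
  by (auto simp: subspace_def Zspace_def linear_add[OF linear_zf] linear_add[OF linear_zf']
      linear_scale[OF linear_zf] linear_scale[OF linear_zf'] linear_0[OF linear_zf] linear_0[OF linear_zf'])

lemma closedin_Zspace:
  assumes p: "1 \<le> p"
  shows "closedin (lp_topology p) (Zspace p R)"
proof -
  let ?ball = "Metric_space.mball (lp p) (\<lambda>x y. lp_norm p (x - y))"
  have "\<exists>r>0. disjnt (Zspace p R) (?ball x r)" if x: "x \<in> lp p - Zspace p R" for x
  proof -
    obtain n s where s: "s \<subseteq> {..n}" "zf p R n s x \<noteq> zf' p R n s x"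
      using x by (auto simp: Zspace_def)
    \<comment> \<open>Half the defect: \<open>zf\<close> and \<open>zf'\<close> are each bounded by
      the norm, so moving by less than \<open>r\<close> changes their difference by less than
      \<open>2 * r\<close>.\<close>
    define r where "r = \<bar>zf p R n s x - zf' p R n s x\<bar> / 2"
    have "y \<notin> ?ball x r" if y: "y \<in> Zspace p R" for y
    proof
      assume "y \<in> ?ball x r"
      hence less: "lp_norm p (x - y) < r"
        by (simp add: Metric_space.in_mball[OF Metric_space_lp[OF p]])
      have d: "x - y \<in> lp p"
        using x y by (intro subspace_diff subspace_lp p) (auto simp: Zspace_def)
      have "2 * r = \<bar>zf p R n s (x - y) - zf' p R n s (x - y)\<bar>"
        using y s by (simp add: r_def linear_diff[OF linear_zf] linear_diff[OF linear_zf'] Zspace_def)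
      also have "\<dots> \<le> 2 * lp_norm p (x - y)"
        using abs_zf_le[OF p d, of R n s] abs_zf'_le[OF p d, of R n s] by linarith
      finally show False using less by simp
    qed
    moreover have "r > 0"
      using s by (simp add: r_def)
    ultimately show ?thesis
      by (auto simp: disjnt_iff)
  qed
  thus ?thesis
    using Zspace_subset_lp
    by (auto simp: lp_topology_def Metric_space.closedin_metric[OF Metric_space_lp[OF p]])
qed

section \<open>Upper \<open>\<ell>\<^sub>2\<close>-estimates and traces\<close>

text \<open>Eta-contraction lets these rules fire on unapplied sums, which turns vectors into abstractions.\<close>

declare plus_fun_apply [simp del] zero_fun_apply [simp del] scaleR_fun_apply [simp del]
  minus_apply [simp del] uminus_apply [simp del]

lemma colour_Un: "u \<subseteq> {..<k} \<Longrightarrow> colour k (g \<union> u) = colour k g"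
  by (auto simp: colour_def)

lemma frozen_Un: "u \<subseteq> {..<k} \<Longrightarrow> frozen R k (g \<union> u) = frozen R k g"
  by (simp add: frozen_def colour_Un)

lemma label_Un_eq:
  assumes "u \<subseteq> {..<k}" "u \<inter> frozen R k g = {}"
  shows "label R k (g \<union> u) = label R k g"
  using assms by (simp add: label_def frozen_Un Int_Un_distrib2)

lemma inj_on_label:
  assumes "V \<subseteq> {..<k}" "V \<subseteq> frozen R k g" "g \<inter> V = {}" "finite g"
  shows "inj_on (\<lambda>u. label R k (g \<union> u)) (Pow V)"
proof (rule inj_onI)
  fix u u' assume uu': "u \<in> Pow V" "u' \<in> Pow V" and eq: "label R k (g \<union> u) = label R k (g \<union> u')"
  have fin: "finite u" "finite u'"
    using assms(1) uu' finite_subset[OF _ finite_lessThan[of k]] by auto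
  have "(g \<union> u) \<inter> frozen R k g = (g \<union> u') \<inter> frozen R k g"
    using eq fin assms(1,4) uu' unfolding label_def
    by (subst (asm) (1 2) frozen_Un) (auto simp: set_encode_eq)
  thus "u = u'"
    using assms(2,3) uu' by blast
qed

text \<open>Changing frozen bits leads to different blocks, so the estimate for disjoint blocks
  applies.\<close>

lemma sum_abs_ef_le:
  assumes p: "1 \<le> p" "x \<in> lp p"
    and V: "V \<subseteq> {..<k}" "V \<subseteq> frozen R k g" "g \<inter> V = {}" "finite g"
  shows "(\<Sum>u\<in>Pow V. \<bar>ef p R k (g \<union> u) x\<bar>) \<le> (2 ^ card V) powr (1 - 1 / p) * lp_norm p x"
proof -
  have "finite V"
    using V(1) finite_subset by blast
  thus ?thesis
    unfolding ef_def
    using sum_abs_bfun_le[OF p _ inj_on_label[OF V], of "Suc (Suc k)" "\<lambda>u. g \<union> u"]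
    by (simp add: card_Pow)
qed

text \<open>Signs suffice as coefficients, because the vectors are later combined with the values of
  \<open>walsh w\<close>.\<close>

definition upper_l2 :: "real \<Rightarrow> nat set \<Rightarrow> real \<Rightarrow> (nat set \<Rightarrow> nat \<Rightarrow> real) \<Rightarrow> bool" where
  "upper_l2 p V c f \<longleftrightarrow> (\<forall>u\<in>Pow V. f u \<in> lp p) \<and>
     (\<forall>\<theta>. (\<forall>u. \<bar>\<theta> u\<bar> = 1) \<longrightarrow> lp_norm p (\<Sum>u\<in>Pow V. \<theta> u *\<^sub>R f u) \<le> c * sqrt (2 ^ card V))"

lemma upper_cong: "(\<And>u. u \<subseteq> V \<Longrightarrow> f u = g u) \<Longrightarrow> upper_l2 p V c f \<longleftrightarrow> upper_l2 p V c g"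
  by (simp add: upper_l2_def)

lemma lp_sum_scaleR:
  "1 \<le> p \<Longrightarrow> (\<And>u. u \<in> A \<Longrightarrow> f u \<in> lp p) \<Longrightarrow> (\<Sum>u\<in>A. \<theta> u *\<^sub>R f u) \<in> lp p"
  by (intro subspace_sum subspace_lp lp_scaleR)

lemma upper_add:
  assumes p: "1 \<le> p" and f: "upper_l2 p V c f" and g: "upper_l2 p V d g"
  shows "upper_l2 p V (c + d) (\<lambda>u. f u + g u)"
  unfolding upper_l2_def
proof (intro conjI ballI allI impI)
  show "f u + g u \<in> lp p" if "u \<in> Pow V" for u
    using f g that p by (simp add: upper_l2_def lp_add)
next
  fix \<theta> :: "nat set \<Rightarrow> real" assume \<theta>: "\<forall>u. \<bar>\<theta> u\<bar> = 1"
  have "lp_norm p (\<Sum>u\<in>Pow V. \<theta> u *\<^sub>R (f u + g u))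
      = lp_norm p ((\<Sum>u\<in>Pow V. \<theta> u *\<^sub>R f u) + (\<Sum>u\<in>Pow V. \<theta> u *\<^sub>R g u))"
    by (simp only: scaleR_add_right sum.distrib)
  also have "\<dots> \<le> lp_norm p (\<Sum>u\<in>Pow V. \<theta> u *\<^sub>R f u) + lp_norm p (\<Sum>u\<in>Pow V. \<theta> u *\<^sub>R g u)"
    using f g by (intro lp_norm_triangle lp_sum_scaleR p) (auto simp: upper_l2_def)
  also have "\<dots> \<le> c * sqrt (2 ^ card V) + d * sqrt (2 ^ card V)"
    using f g \<theta> unfolding upper_l2_def by (intro add_mono) blast+
  finally show "lp_norm p (\<Sum>u\<in>Pow V. \<theta> u *\<^sub>R (f u + g u)) \<le> (c + d) * sqrt (2 ^ card V)"
    by (simp add: distrib_right)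
qed

lemma upper_scale_sign:
  assumes \<sigma>: "\<bar>\<sigma>\<bar> = 1" and f: "upper_l2 p V c f"
  shows "upper_l2 p V c (\<lambda>u. \<sigma> *\<^sub>R f u)"
  unfolding upper_l2_def
proof (intro conjI ballI allI impI)
  show "\<sigma> *\<^sub>R f u \<in> lp p" if "u \<in> Pow V" for u
    using f that by (simp add: upper_l2_def lp_scaleR)
next
  fix \<theta> :: "nat set \<Rightarrow> real" assume "\<forall>u. \<bar>\<theta> u\<bar> = 1"
  hence "\<forall>u. \<bar>\<theta> u * \<sigma>\<bar> = 1"
    using \<sigma> by (simp add: abs_mult)
  hence "lp_norm p (\<Sum>u\<in>Pow V. (\<theta> u * \<sigma>) *\<^sub>R f u) \<le> c * sqrt (2 ^ card V)"
    using f[unfolded upper_l2_def, THEN conjunct2, THEN spec[of _ "\<lambda>u. \<theta> u * \<sigma>"]] by blast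
  thus "lp_norm p (\<Sum>u\<in>Pow V. \<theta> u *\<^sub>R (\<sigma> *\<^sub>R f u)) \<le> c * sqrt (2 ^ card V)"
    by simp
qed

lemma upper_diff:
  assumes "1 \<le> p" "upper_l2 p V c f" "upper_l2 p V d g"
  shows "upper_l2 p V (c + d) (\<lambda>u. f u - g u)"
  using upper_add[OF assms(1,2) upper_scale_sign[of "-1", OF _ assms(3)]] by simp

lemma upper_sum:
  assumes "1 \<le> p" "finite I" "\<And>i. i \<in> I \<Longrightarrow> upper_l2 p V 1 (f i)"
  shows "upper_l2 p V (card I) (\<lambda>u. \<Sum>i\<in>I. f i u)"
  using assms(2,3)
proof (induction I rule: finite_induct)
  case empty
  have "(0::nat \<Rightarrow> real) \<in> lp p"
    using assms(1) subspace_0 subspace_lp by blast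
  hence "upper_l2 p V 0 (\<lambda>u. 0)"
    unfolding upper_l2_def using assms(1) by simp
  thus ?case by simp
next
  case (insert i I)
  show ?case
    using upper_add[OF assms(1), of V 1 "f i" "card I"] insert by simp
qed

text \<open>No bit of \<open>V\<close> is frozen, so all strings \<open>g \<union> u\<close> share
  one label and the estimate inside a block applies.\<close>

lemma upper_ev:
  assumes p: "1 \<le> p" "p < 2"
    and V: "V \<subseteq> {..<k}" "V \<inter> frozen R k g = {}" "g \<inter> V = {}" "g \<subseteq> {..Suc k}"
  shows "upper_l2 p V 1 (\<lambda>u. ev p R k (g \<union> u))"
  unfolding upper_l2_def
proof (intro conjI ballI allI impI)
  fix \<theta> :: "nat set \<Rightarrow> real" assume \<theta>: "\<forall>u. \<bar>\<theta> u\<bar> = 1"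
  have fin: "finite V"
    using V(1) finite_subset by blast
  have "label R k (g \<union> u) = label R k g" if "u \<in> Pow V" for u
    using V that by (intro label_Un_eq) auto
  hence eq: "(\<Sum>u\<in>Pow V. \<theta> u *\<^sub>R ev p R k (g \<union> u))
      = (\<Sum>u\<in>Pow V. \<theta> u *\<^sub>R bvec p (Suc (Suc k)) (label R k g) (g \<union> u))"
    by (simp add: ev_def)
  have "lp_norm p (\<Sum>u\<in>Pow V. \<theta> u *\<^sub>R ev p R k (g \<union> u)) \<le> sqrt (\<Sum>u\<in>Pow V. (\<theta> u)\<^sup>2)"
    unfolding eq
  proof (rule lp_norm_sum_bvec[OF p])
    show "inj_on (\<lambda>u. g \<union> u) (Pow V)"
      using V(3) unfolding inj_on_def by blast
    show "g \<union> u \<subseteq> {..<Suc (Suc k)}" if "u \<in> Pow V" for u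
      using V that by fastforce
  qed (use fin in simp)
  also have "(\<Sum>u\<in>Pow V. (\<theta> u)\<^sup>2) = (\<Sum>u\<in>Pow V. 1)"
    by (intro sum.cong refl) (metis \<theta> one_power2 power2_abs)
  finally show "lp_norm p (\<Sum>u\<in>Pow V. \<theta> u *\<^sub>R ev p R k (g \<union> u)) \<le> 1 * sqrt (2 ^ card V)"
    using fin by (simp add: card_Pow)
qed simp

section \<open>Bounded operators and their averaged traces\<close>

definition bounded_on :: "real \<Rightarrow> (nat \<Rightarrow> real) set \<Rightarrow> real \<Rightarrow> ((nat \<Rightarrow> real) \<Rightarrow> nat \<Rightarrow> real) \<Rightarrow> bool" where
  "bounded_on p Z K T \<longleftrightarrow>
     (\<forall>x\<in>Z. \<forall>y\<in>Z. T (x + y) = T x + T y) \<and>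
     (\<forall>c. \<forall>x\<in>Z. T (c *\<^sub>R x) = c *\<^sub>R T x) \<and>
     (\<forall>x\<in>Z. T x \<in> lp p \<and> lp_norm p (T x) \<le> K * lp_norm p x)"

lemma bounded_on_sum:
  assumes "bounded_on p Z K T" "subspace Z" "\<And>i. i \<in> I \<Longrightarrow> f i \<in> Z"
  shows "T (\<Sum>i\<in>I. c i *\<^sub>R f i) = (\<Sum>i\<in>I. c i *\<^sub>R T (f i))"
proof -
  have T0: "T 0 = 0"
    using assms(1) subspace_0[OF assms(2)] unfolding bounded_on_def
    by (metis scaleR_zero_left)
  show ?thesis
    using assms(3)
  proof (induction I rule: infinite_finite_induct)
    case (insert i I)
    have "c i *\<^sub>R f i \<in> Z" "(\<Sum>i\<in>I. c i *\<^sub>R f i) \<in> Z"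
      using insert.prems assms(2) by (auto intro!: subspace_sum subspace_scale)
    thus ?case
      using insert assms(1) by (simp add: bounded_on_def)
  qed (simp_all add: T0)
qed

lemma bounded_on_diff:
  assumes "bounded_on p Z K T" "subspace Z" "x \<in> Z" "y \<in> Z"
  shows "T (x - y) = T x - T y"
  using bounded_on_sum[OF assms(1,2), of "{False, True}" "\<lambda>b. if b then x else y" "\<lambda>b. if b then 1 else -1"] assms(3,4)
  by simp

text \<open>Signs \<open>walsh w\<close> isolate the diagonal. With \<open>M = 2 ^ card V\<close>,
  the functionals contribute \<open>M powr (1 - 1 / p)\<close> and the vectors
  \<open>M powr (1 / 2)\<close>; the product is \<open>M\<close> times
  \<open>M powr (1 / 2 - 1 / p)\<close>, a gain over \<open>M\<close> when
  \<open>p < 2\<close>.\<close>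

lemma fibre_trace_le:
  assumes p: "1 \<le> p" and V: "finite V"
    and T: "bounded_on p Z K T" "subspace Z" "0 \<le> K"
    and f: "upper_l2 p V c f" "\<And>u. u \<subseteq> V \<Longrightarrow> f u \<in> Z"
    and \<phi>: "\<And>u. linear (\<phi> u)"
      "\<And>x. x \<in> lp p \<Longrightarrow> (\<Sum>u\<in>Pow V. \<bar>\<phi> u x\<bar>) \<le> (2 ^ card V) powr (1 - 1 / p) * lp_norm p x"
  shows "\<bar>\<Sum>u\<in>Pow V. \<phi> u (T (f u))\<bar> \<le> (c * K * (2 powr (1 / 2 - 1 / p)) ^ card V) * 2 ^ card V"
proof (rule diagonal_le_walsh_average[OF V, where \<psi> = "\<lambda>u v. \<phi> u (T (f v))"])
  fix w assume "w \<subseteq> V"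
  define x where "x = (\<Sum>v\<in>Pow V. walsh w v *\<^sub>R f v)"
  have x: "x \<in> Z"
    unfolding x_def using f T by (intro subspace_sum subspace_scale) auto
  have Tx: "T x \<in> lp p" "lp_norm p (T x) \<le> K * lp_norm p x"
    using T x by (auto simp: bounded_on_def)
  have "(\<Sum>u\<in>Pow V. \<bar>\<Sum>v\<in>Pow V. walsh w v * \<phi> u (T (f v))\<bar>) = (\<Sum>u\<in>Pow V. \<bar>\<phi> u (T x)\<bar>)"
    unfolding x_def using f(2)
    by (subst bounded_on_sum[OF T(1,2)])
      (auto simp: linear_sum[OF \<phi>(1)] linear_scale[OF \<phi>(1)])
  also have "\<dots> \<le> (2 ^ card V) powr (1 - 1 / p) * lp_norm p (T x)"
    by (rule \<phi>(2)[OF Tx(1)])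
  also have "\<dots> \<le> (2 ^ card V) powr (1 - 1 / p) * (K * (c * sqrt (2 ^ card V)))"
    using Tx(2) f(1) T(3) unfolding x_def upper_l2_def
    by (intro mult_left_mono order.trans[OF Tx(2)[unfolded x_def]]) auto
  also have "\<dots> = c * K * ((2 ^ card V) powr (1 - 1 / p) * (2 ^ card V) powr (1 / 2))"
    by (simp add: powr_half_sqrt)
  also have "(2 ^ card V) powr (1 - 1 / p) * (2 ^ card V) powr (1 / 2)
      = (2 powr (1 / 2 - 1 / p)) ^ card V * (2 ^ card V :: real)"
    by (simp add: powr_power powr_realpow[symmetric] powr_powr algebra_simps flip: powr_add)
  finally show "(\<Sum>u\<in>Pow V. \<bar>\<Sum>v\<in>Pow V. walsh w v * \<phi> u (T (f v))\<bar>)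
      \<le> (c * K * (2 powr (1 / 2 - 1 / p)) ^ card V) * 2 ^ card V"
    by (simp add: mult.assoc)
qed

definition mean_trace :: "real \<Rightarrow> nat set \<Rightarrow> nat set \<Rightarrow> nat \<Rightarrow> ((nat \<Rightarrow> real) \<Rightarrow> nat \<Rightarrow> real) \<Rightarrow> real" where
  "mean_trace p R R' n T = (\<Sum>s\<in>Pow {..n}. zf p R' n s (T (zv p R n s))) / 2 ^ Suc n"

text \<open>Bits of \<open>R\<close> are frozen for every colour, so both halves of
  \<open>zf\<close> are spread over different blocks.\<close>

lemma sum_abs_zf_le:
  assumes p: "1 \<le> p" "x \<in> lp p"
    and V: "V \<subseteq> {..<n}" "V \<subseteq> R" "g \<inter> V = {}" "finite g"
  shows "(\<Sum>u\<in>Pow V. \<bar>zf p R n (g \<union> u) x\<bar>) \<le> (2 ^ card V) powr (1 - 1 / p) * lp_norm p x"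
proof -
  have "(\<Sum>u\<in>Pow V. \<bar>ef p R n (g \<union> u) x\<bar>) \<le> (2 ^ card V) powr (1 - 1 / p) * lp_norm p x"
    using V by (intro sum_abs_ef_le p) (auto simp: frozen_def)
  moreover have "(\<Sum>u\<in>Pow V. \<bar>ef p R n (insert (Suc n) g \<union> u) x\<bar>)
      \<le> (2 ^ card V) powr (1 - 1 / p) * lp_norm p x"
    using V by (intro sum_abs_ef_le p) (auto simp: frozen_def)
  moreover have "(\<Sum>u\<in>Pow V. \<bar>zf p R n (g \<union> u) x\<bar>)
      \<le> (\<Sum>u\<in>Pow V. (\<bar>ef p R n (g \<union> u) x\<bar> + \<bar>ef p R n (insert (Suc n) g \<union> u) x\<bar>) / 2)"
    by (intro sum_mono) (simp add: zf_def)
  ultimately show ?thesis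
    by (simp add: sum.distrib flip: sum_divide_distrib)
qed

text \<open>Colours are below \<open>8\<close> and \<open>V\<close> avoids \<open>R\<close>, so no
  bit of \<open>V\<close> is ever frozen. The constant \<open>6\<close> counts the two plus four
  summands of \<open>zv\<close>.\<close>

lemma upper_zv:
  assumes p: "1 \<le> p" "p < 2"
    and V: "V \<subseteq> {..<n}" "V \<inter> R = {}" "\<And>i. i \<in> V \<Longrightarrow> i mod 9 = 8" "g \<inter> V = {}" "g \<subseteq> {..n}"
  shows "upper_l2 p V 6 (\<lambda>u. zv p R n (g \<union> u))"
proof -
  have colour: "colour k m < 8" for k m
  proof -
    have "k mod 2 \<le> 1" by simp
    thus ?thesis by (simp only: colour_def) (auto split: if_splits)
  qed
  have frozen: "V \<inter> frozen R k m = {}" for k m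
    using V(2,3) colour[of k m] by (auto simp: frozen_def)
  have "upper_l2 p V (1 + 1 + real (card (Pow {Suc n, Suc (Suc n)}))) (\<lambda>u. ev p R n (g \<union> u)
      - ev p R n (insert (Suc n) g \<union> u)
      + (\<Sum>d\<in>Pow {Suc n, Suc (Suc n)}. ev p R (Suc n) (g \<union> d \<union> u)))"
  proof (intro upper_add upper_diff upper_sum upper_ev p frozen)
    have notin: "i \<notin> V" if "n \<le> i" for i
      using V(1) that by auto
    show "V \<subseteq> {..<Suc n}"
      by (rule subset_trans[OF V(1)]) auto
    show g: "g \<subseteq> {..Suc n}"
      by (rule subset_trans[OF V(5)]) auto
    thus "insert (Suc n) g \<subseteq> {..Suc n}"
      by simp
    show "insert (Suc n) g \<inter> V = {}"
      using V(4) notin[of "Suc n"] by simp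
    fix d assume "d \<in> Pow {Suc n, Suc (Suc n)}"
    hence d: "d \<subseteq> {Suc n, Suc (Suc n)}" by (rule PowD)
    show "(g \<union> d) \<inter> V = {}"
      by (rule Un_disjoint[OF V(4) d]) (simp add: notin)
    show "g \<union> d \<subseteq> {..Suc (Suc n)}"
      by (rule Un_least_trans[OF V(5) _ d]) auto
  qed (simp_all add: V(1,4))
  thus ?thesis
    by (simp add: zv_def card_Pow Un_ac)
qed

text \<open>The bits of \<open>R' - R\<close> are free for the vectors, which are built from
  \<open>R\<close>, and frozen for the functionals, which are built from \<open>R'\<close>. The
  fibre estimate along those below \<open>n\<close> is then averaged.\<close>

lemma mean_trace_small:
  assumes p: "1 \<le> p" "p < 2"
    and R: "\<And>i. i \<in> R' \<Longrightarrow> i mod 9 = 8"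
    and T: "bounded_on p (Zspace p R) K T" "0 \<le> K"
  shows "\<bar>mean_trace p R R' n T\<bar> \<le> 6 * K * (2 powr (1 / 2 - 1 / p)) ^ card ((R' - R) \<inter> {..<n})"
proof -
  define V where "V = (R' - R) \<inter> {..<n}"
  have V: "V \<subseteq> {..<n}" "finite V"
    by (auto simp: V_def)
  have "\<bar>\<Sum>s\<in>Pow {..n}. zf p R' n s (T (zv p R n s))\<bar>
      \<le> (6 * K * (2 powr (1 / 2 - 1 / p)) ^ card V) * card (Pow {..n})"
  proof (rule sum_le_fibrewise[where V = "\<lambda>_. V"])
    fix s u assume "s \<in> Pow {..n}" "u \<subseteq> V"
    thus "s - V \<union> u \<in> Pow {..n} \<and> V = V"
      using V by fastforce
  next
    fix s assume "s \<in> Pow {..n}"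
    hence s: "s - V \<subseteq> {..n}" "(s - V) \<inter> V = {}" "finite (s - V)"
      by (auto intro: finite_subset)
    show "\<bar>\<Sum>u\<in>Pow V. zf p R' n (s - V \<union> u) (T (zv p R n (s - V \<union> u)))\<bar>
        \<le> 6 * K * (2 powr (1 / 2 - 1 / p)) ^ card V * 2 ^ card V"
    proof (rule fibre_trace_le[OF p(1) V(2) T(1) subspace_Zspace[OF p(1)] T(2)])
      show "upper_l2 p V 6 (\<lambda>u. zv p R n (s - V \<union> u))"
        by (rule upper_zv[OF p V(1) _ _ s(2,1)]) (auto simp: V_def R)
      show "zv p R n (s - V \<union> u) \<in> Zspace p R" if "u \<subseteq> V" for u
        using that s V by (intro zv_in_Zspace p) fastforce
      show "(\<Sum>u\<in>Pow V. \<bar>zf p R' n (s - V \<union> u) x\<bar>) \<le> (2 ^ card V) powr (1 - 1 / p) * lp_norm p x"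
        if "x \<in> lp p" for x
        by (rule sum_abs_zf_le[OF p(1) that V(1) _ s(2,3)]) (auto simp: V_def)
    qed (rule linear_zf)
  qed (use V in auto)
  thus ?thesis
    by (simp add: mean_trace_def V_def card_Pow field_simps)
qed

section \<open>Traces at consecutive levels\<close>

lemma sum_Pow_atMost_Suc:
  fixes f :: "nat set \<Rightarrow> 'a::comm_monoid_add"
  shows "(\<Sum>m\<in>Pow {..Suc n}. f m) = (\<Sum>s\<in>Pow {..n}. f s + f (insert (Suc n) s))"
proof -
  have "inj_on (insert (Suc n)) (Pow {..n})"
  proof (rule inj_onI)
    fix s t assume "s \<in> Pow {..n}" "t \<in> Pow {..n}" "insert (Suc n) s = insert (Suc n) t"
    thus "s = t"
      by (subst (asm) insert_ident) auto
  qed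
  moreover have "Pow {..n} \<inter> insert (Suc n) ` Pow {..n} = {}"
    by auto
  ultimately show ?thesis
    by (simp add: atMost_Suc Pow_insert sum.union_disjoint sum.reindex sum.distrib)
qed

text \<open>Paired through \<open>T\<close> with \<open>ef p R' (Suc n) m\<close>, this gives the
  term of index \<open>m\<close> in the difference of two consecutive traces; the sign is the one
  with which that functional occurs in \<open>zf\<close>.\<close>

definition yv :: "real \<Rightarrow> nat set \<Rightarrow> nat \<Rightarrow> nat set \<Rightarrow> nat \<Rightarrow> real" where
  "yv p R n m = (if Suc (Suc n) \<in> m then -1 else 1) *\<^sub>R zv p R (Suc n) (m \<inter> {..Suc n})
     - zv p R n (m \<inter> {..n})"

lemma yv_in_Zspace: "1 \<le> p \<Longrightarrow> yv p R n m \<in> Zspace p R"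
  unfolding yv_def
  by (intro subspace_diff subspace_scale subspace_Zspace zv_in_Zspace) auto

text \<open>
  The trace at level \<open>n + 1\<close> is written with the functionals \<open>zf\<close>, the one at level \<open>n\<close> with
  \<open>zf'\<close>; both are then combinations of the same functionals \<open>ef\<close> of level \<open>n + 1\<close>.
\<close>

lemma mean_trace_Suc_diff:
  assumes p: "1 \<le> p" and T: "bounded_on p (Zspace p R) K T" "\<And>x. x \<in> Zspace p R \<Longrightarrow> T x \<in> Zspace p R'"
  shows "mean_trace p R R' (Suc n) T - mean_trace p R R' n T
    = (\<Sum>m\<in>Pow {..Suc (Suc n)}. ef p R' (Suc n) m (T (yv p R n m))) / 2 ^ (n + 3)"
proof -
  let ?E = "\<lambda>m x. ef p R' (Suc n) m (T x)"
  let ?\<sigma> = "\<lambda>m. if Suc (Suc n) \<in> m then -1 else 1 :: real"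
  have Z: "zv p R (Suc n) (m \<inter> {..Suc n}) \<in> Zspace p R" "zv p R n (m \<inter> {..n}) \<in> Zspace p R" for m
    by (auto intro: zv_in_Zspace p)
  have y: "?E m (yv p R n m)
      = ?\<sigma> m * ?E m (zv p R (Suc n) (m \<inter> {..Suc n})) - ?E m (zv p R n (m \<inter> {..n}))" for m
  proof -
    have "T (yv p R n m) = ?\<sigma> m *\<^sub>R T (zv p R (Suc n) (m \<inter> {..Suc n})) - T (zv p R n (m \<inter> {..n}))"
      using T(1) Z(1) unfolding yv_def
        bounded_on_diff[OF T(1) subspace_Zspace[OF p] subspace_scale[OF subspace_Zspace[OF p] Z(1)] Z(2)]
      by (simp only: bounded_on_def)
    thus ?thesis
      by (simp only: linear_diff[OF linear_ef] linear_scale[OF linear_ef] real_scaleR_def)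
  qed
  have "(\<Sum>m\<in>Pow {..Suc (Suc n)}. ?\<sigma> m * ?E m (zv p R (Suc n) (m \<inter> {..Suc n})))
      = (\<Sum>s\<in>Pow {..Suc n}. 2 * zf p R' (Suc n) s (T (zv p R (Suc n) s)))"
    unfolding sum_Pow_atMost_Suc[of _ "Suc n"]
  proof (intro sum.cong refl)
    fix s assume "s \<in> Pow {..Suc n}"
    hence "Suc (Suc n) \<notin> s" "s \<inter> {..Suc n} = s" "insert (Suc (Suc n)) s \<inter> {..Suc n} = s"
      by auto
    thus "?\<sigma> s * ?E s (zv p R (Suc n) (s \<inter> {..Suc n}))
        + ?\<sigma> (insert (Suc (Suc n)) s) * ?E (insert (Suc (Suc n)) s)
            (zv p R (Suc n) (insert (Suc (Suc n)) s \<inter> {..Suc n}))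
        = 2 * zf p R' (Suc n) s (T (zv p R (Suc n) s))"
      by (simp add: zf_def)
  qed
  \<comment> \<open>Both traces get the same weight \<open>1 / 2 ^ (n + 3)\<close>: here
    \<open>1 / 2\<close> from \<open>zf\<close> over \<open>2 ^ (n + 2)\<close>, below
    \<open>1 / 4\<close> from \<open>zf'\<close> over \<open>2 ^ (n + 1)\<close>.\<close>
  hence 1: "(\<Sum>m\<in>Pow {..Suc (Suc n)}. ?\<sigma> m * ?E m (zv p R (Suc n) (m \<inter> {..Suc n}))) / 2 ^ (n + 3)
      = mean_trace p R R' (Suc n) T"
    by (simp add: mean_trace_def power_add flip: sum_distrib_left)
  have "(\<Sum>m\<in>Pow {..Suc (Suc n)}. ?E m (zv p R n (m \<inter> {..n})))
      = (\<Sum>s\<in>Pow {..n}. 4 * zf' p R' n s (T (zv p R n s)))"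
    unfolding sum_Pow_atMost_Suc
  proof (intro sum.cong refl)
    fix s assume "s \<in> Pow {..n}"
    hence "s \<inter> {..n} = s" "insert (Suc n) s \<inter> {..n} = s" "insert (Suc (Suc n)) s \<inter> {..n} = s"
      "insert (Suc (Suc n)) (insert (Suc n) s) \<inter> {..n} = s"
      by auto
    thus "?E s (zv p R n (s \<inter> {..n})) + ?E (insert (Suc (Suc n)) s) (zv p R n (insert (Suc (Suc n)) s \<inter> {..n}))
        + (?E (insert (Suc n) s) (zv p R n (insert (Suc n) s \<inter> {..n}))
          + ?E (insert (Suc (Suc n)) (insert (Suc n) s))
              (zv p R n (insert (Suc (Suc n)) (insert (Suc n) s) \<inter> {..n})))
        = 4 * zf' p R' n s (T (zv p R n s))"
      unfolding zf'_def sum_Pow_doubleton[OF n_not_Suc_n] by (simp add: insert_commute)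
  qed
  \<comment> \<open>Values of \<open>T\<close> lie in \<open>Zspace p R'\<close>, where
    \<open>zf'\<close> and \<open>zf\<close> agree.\<close>
  also have "\<dots> = (\<Sum>s\<in>Pow {..n}. 4 * zf p R' n s (T (zv p R n s)))"
  proof (intro sum.cong refl)
    fix s assume "s \<in> Pow {..n}"
    hence "s \<subseteq> {..n}" "T (zv p R n s) \<in> Zspace p R'"
      using T(2) by (auto intro: zv_in_Zspace p)
    thus "4 * zf' p R' n s (T (zv p R n s)) = 4 * zf p R' n s (T (zv p R n s))"
      by (simp add: Zspace_def)
  qed
  finally have 2: "(\<Sum>m\<in>Pow {..Suc (Suc n)}. ?E m (zv p R n (m \<inter> {..n}))) / 2 ^ (n + 3) = mean_trace p R R' n T"
    by (simp add: mean_trace_def power_add flip: sum_distrib_left)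
  show ?thesis
    by (simp only: y sum_subtractf diff_divide_distrib 1 2)
qed

text \<open>
  The contribution of \<open>ev p R (Suc n) m\<close> itself cancels in \<open>yv p R n m\<close>; all the remaining
  vectors have colours different from that of \<open>m\<close>.
\<close>

lemma upper_yv:
  assumes p: "1 \<le> p" "p < 2"
    and V: "V \<subseteq> {..<n}" "V \<inter> R = {}" "\<And>i. i \<in> V \<Longrightarrow> i mod 9 = colour (Suc n) t" "t \<inter> V = {}"
    and t: "t \<subseteq> {..Suc (Suc n)}"
  shows "upper_l2 p V 10 (\<lambda>u. yv p R n (t \<union> u))"
proof -
  \<comment> \<open>\<open>b\<close> holds the last two bits of \<open>t\<close>, and
    \<open>t'\<close> is \<open>t\<close> with its last bit flipped.\<close>
  define s s1 b t' where "s = t \<inter> {..n}" and "s1 = t \<inter> {..Suc n}"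
    and "b = t \<inter> {Suc n, Suc (Suc n)}"
    and "t' = (if Suc (Suc n) \<in> t then t - {Suc (Suc n)} else insert (Suc (Suc n)) t)"
  define \<sigma> :: real where "\<sigma> = (if Suc (Suc n) \<in> t then -1 else 1)"
  let ?D = "{Suc n, Suc (Suc n)}" and ?D1 = "{Suc (Suc n), Suc (Suc (Suc n))}"
  have frozen: "V \<inter> frozen R k g = {}" if "colour k g \<noteq> colour (Suc n) t" for k g
    using V(2,3) that by (auto simp: frozen_def)
  have colour_parity: "colour k g \<noteq> colour k' g'" if "k mod 2 \<noteq> k' mod 2" for k k' g g'
  proof -
    have "(4 * (k mod 2) + r) div 4 = k mod 2" if "r < 4" for k r :: nat
      using that by simp
    hence "colour k g div 4 = k mod 2" for k g
      unfolding colour_def add.assoc by simp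
    thus ?thesis using that by metis
  qed
  have colour_other: "colour (Suc (Suc n)) g \<noteq> colour (Suc n) t" "colour n g \<noteq> colour (Suc n) t" for g
    by (rule colour_parity, simp add: mod_Suc)+
  have t_decomp: "t = s \<union> b"
    using t unfolding s_def b_def by (fastforce simp: le_Suc_eq)
  have notin: "x \<notin> V" if "n \<le> x" for x
    using V(1) that by fastforce
  have Vt: "s \<inter> V = {}" "s1 \<inter> V = {}" "t' \<inter> V = {}" "?D \<inter> V = {}" "?D1 \<inter> V = {}"
    using notin[of "Suc n"] notin[of "Suc (Suc n)"] notin[of "Suc (Suc (Suc n))"] V(4)
    unfolding s_def s1_def t'_def by auto
  have Vn: "V \<subseteq> {..<Suc n}" "V \<subseteq> {..<Suc (Suc n)}"
    using V(1) by fastforce+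
  have s: "s \<subseteq> {..n}" "s1 \<subseteq> {..Suc n}"
    by (auto simp: s_def s1_def)
  have sub: "s \<subseteq> {..Suc n}" "t' \<subseteq> {..Suc (Suc n)}"
    using s t by (auto simp: t'_def)
  have sub_D: "s1 \<union> d \<subseteq> {..Suc (Suc (Suc n))}" "(s1 \<union> d) \<inter> V = {}" if "d \<subseteq> ?D1" for d
    by (rule Un_least_trans[OF s(2) _ that], simp_all only: Un_disjoint[OF Vt(2) that Vt(5)]) auto
  have sub_D': "s \<union> d \<subseteq> {..Suc (Suc n)}" "(s \<union> d) \<inter> V = {}" if "d \<subseteq> ?D" for d
    by (rule Un_least_trans[OF s(1) _ that], simp_all only: Un_disjoint[OF Vt(1) that Vt(4)]) auto
  have decomp: "yv p R n (t \<union> u) =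
      \<sigma> *\<^sub>R (\<Sum>d\<in>Pow ?D1. ev p R (Suc (Suc n)) (s1 \<union> d \<union> u)) + ev p R n (insert (Suc n) s \<union> u)
      - ev p R (Suc n) (t' \<union> u) - ev p R n (s \<union> u) - (\<Sum>d\<in>Pow ?D - {b}. ev p R (Suc n) (s \<union> d \<union> u))"
    if u: "u \<subseteq> V" for u
  proof -
    have un: "u \<subseteq> {..<n}"
      using u V(1) by blast
    have int: "(t \<union> u) \<inter> {..n} = s \<union> u" "(t \<union> u) \<inter> {..Suc n} = s1 \<union> u"
      using un unfolding s_def s1_def by fastforce+
    have sgn: "(if Suc (Suc n) \<in> t \<union> u then -1 else 1) = \<sigma>"
      using un by (auto simp: \<sigma>_def)
    \<comment> \<open>The sign \<open>\<sigma>\<close> gives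
      \<open>ev p R (Suc n) (t \<union> u)\<close> the coefficient \<open>1\<close> in either case;
      it cancels against the summand \<open>d = b\<close> of the next sum.\<close>
    have "\<sigma> *\<^sub>R (ev p R (Suc n) (s1 \<union> u) - ev p R (Suc n) (insert (Suc (Suc n)) (s1 \<union> u)))
        = ev p R (Suc n) (t \<union> u) - ev p R (Suc n) (t' \<union> u)"
    proof (cases "Suc (Suc n) \<in> t")
      case True
      hence "s1 = t'" "insert (Suc (Suc n)) s1 = t"
        using t by (fastforce simp: s1_def t'_def le_Suc_eq)+
      thus ?thesis
        using True by (simp add: \<sigma>_def flip: Un_insert_left)
    next
      case False
      hence "s1 = t" "insert (Suc (Suc n)) s1 = t'"
        using t by (fastforce simp: s1_def t'_def le_Suc_eq)+
      thus ?thesis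
        using False by (simp add: \<sigma>_def flip: Un_insert_left)
    qed
    moreover have "(\<Sum>d\<in>Pow ?D. ev p R (Suc n) (s \<union> u \<union> d))
        = ev p R (Suc n) (t \<union> u) + (\<Sum>d\<in>Pow ?D - {b}. ev p R (Suc n) (s \<union> d \<union> u))"
    proof -
      have "b \<in> Pow ?D" by (auto simp: b_def)
      moreover have "s \<union> u \<union> d = s \<union> d \<union> u" for d by blast
      ultimately show ?thesis
        by (simp only: t_decomp sum.remove[of "Pow ?D" b] finite_Pow_iff finite.intros)
    qed
    moreover have "s1 \<union> u \<union> d = s1 \<union> d \<union> u" for d by blast
    ultimately show ?thesis
      unfolding yv_def int sgn zv_def scaleR_add_right by (simp add: algebra_simps)
  qed
  have card: "card (Pow ?D1) = 4" "card (Pow ?D - {b}) = 3"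
    by (auto simp: card_Pow b_def)
  \<comment> \<open>The constant is \<open>4 + 1 + 1 + 1 + 3 = 10\<close>. Vectors of other levels
    differ in colour by parity, those of level \<open>Suc n\<close> by one of their last two
    bits.\<close>
  have "upper_l2 p V (real (card (Pow ?D1)) + 1 + 1 + 1 + real (card (Pow ?D - {b})))
     (\<lambda>u. \<sigma> *\<^sub>R (\<Sum>d\<in>Pow ?D1. ev p R (Suc (Suc n)) (s1 \<union> d \<union> u)) + ev p R n (insert (Suc n) s \<union> u)
      - ev p R (Suc n) (t' \<union> u) - ev p R n (s \<union> u) - (\<Sum>d\<in>Pow ?D - {b}. ev p R (Suc n) (s \<union> d \<union> u)))"
  proof (intro upper_add upper_diff upper_scale_sign upper_sum upper_ev p frozen)
    show "colour (Suc n) t' \<noteq> colour (Suc n) t"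
      by (auto simp: colour_def t'_def)
    show "colour (Suc n) (s \<union> d) \<noteq> colour (Suc n) t" if "d \<in> Pow ?D - {b}" for d
    proof -
      have "Suc n \<notin> s" "Suc (Suc n) \<notin> s"
        by (auto simp: s_def)
      moreover have "(Suc n \<in> d) \<noteq> (Suc n \<in> b) \<or> (Suc (Suc n) \<in> d) \<noteq> (Suc (Suc n) \<in> b)"
        using that by (auto simp: b_def)
      ultimately show ?thesis
        unfolding t_decomp by (auto simp: colour_def split: if_splits)
    qed
    show "s1 \<union> d \<subseteq> {..Suc (Suc (Suc n))}" if "d \<in> Pow ?D1" for d
      by (rule sub_D(1)[OF PowD[OF that]])
    show "s \<union> d \<subseteq> {..Suc (Suc n)}" if "d \<in> Pow ?D - {b}" for d
      by (rule sub_D'(1)[OF PowD[OF DiffD1[OF that]]])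
  qed (simp_all add: colour_other V(1) Vt Vn sub sub_D sub_D' notin \<sigma>_def)
  thus ?thesis
    unfolding card using decomp by (subst upper_cong) auto
qed

text \<open>The fibre through \<open>m\<close> varies bits whose residue modulo \<open>9\<close> is
  the colour of \<open>m\<close>: frozen for the functional, free for every vector left in
  \<open>yv\<close>. Below \<open>n\<close> there are \<open>n div 9\<close> full periods to choose
  from.\<close>

lemma mean_trace_Suc_diff_le:
  assumes p: "1 \<le> p" "p < 2"
    and R: "\<And>i. i \<in> R \<Longrightarrow> i mod 9 = 8"
    and T: "bounded_on p (Zspace p R) K T" "0 \<le> K" "\<And>x. x \<in> Zspace p R \<Longrightarrow> T x \<in> Zspace p R'"
  shows "\<bar>mean_trace p R R' (Suc n) T - mean_trace p R R' n T\<bar> \<le> 10 * K * (2 powr (1 / 2 - 1 / p)) ^ (n div 9)"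
proof -
  define V where "V m = (\<lambda>j. 9 * j + colour (Suc n) m) ` {..<n div 9}" for m
  have colour: "colour (Suc n) m < 8" for m
  proof -
    have "Suc n mod 2 \<le> 1" by simp
    thus ?thesis by (simp only: colour_def) (auto split: if_splits)
  qed
  have V_mod: "i mod 9 = colour (Suc n) m" if "i \<in> V m" for i m
    using that colour[of m] by (auto simp: V_def)
  have V: "V m \<subseteq> {..<n}" "finite (V m)" "card (V m) = n div 9" "V m \<inter> R = {}" for m
  proof -
    show "V m \<subseteq> {..<n}"
    proof
      fix i assume "i \<in> V m"
      then obtain j where "j < n div 9" "i = 9 * j + colour (Suc n) m"
        by (auto simp: V_def)
      thus "i \<in> {..<n}"
        using colour[of m] by simp
    qed
    show "finite (V m)" by (simp add: V_def)
    show "card (V m) = n div 9"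
      by (simp add: V_def card_image inj_on_def)
    show "V m \<inter> R = {}"
      using V_mod[of _ m] R colour[of m] by fastforce
  qed
  \<comment> \<open>The colour reads only the bits \<open>Suc n\<close> and
    \<open>Suc (Suc n)\<close>, which lie outside \<open>V m\<close>.\<close>
  have V_eq: "V (m - V m \<union> u) = V m" if "u \<subseteq> V m" for m u
  proof -
    have "m - V m \<union> u = (m - V m) \<union> u" "m = (m - V m) \<union> (m \<inter> V m)" by auto
    hence "colour (Suc n) (m - V m \<union> u) = colour (Suc n) m"
      using that V(1)[of m] colour_Un[of u "Suc n" "m - V m"] colour_Un[of "m \<inter> V m" "Suc n" "m - V m"]
      by (metis (no_types, lifting) inf.coboundedI2 lessThan_Suc order_trans subset_insertI)
    thus ?thesis by (simp add: V_def)
  qed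
  have "\<bar>\<Sum>m\<in>Pow {..Suc (Suc n)}. ef p R' (Suc n) m (T (yv p R n m))\<bar>
      \<le> (10 * K * (2 powr (1 / 2 - 1 / p)) ^ (n div 9)) * card (Pow {..Suc (Suc n)})"
  proof (rule sum_le_fibrewise[where V = V])
    fix m u assume m: "m \<in> Pow {..Suc (Suc n)}" and u: "u \<subseteq> V m"
    show "m - V m \<union> u \<in> Pow {..Suc (Suc n)} \<and> V (m - V m \<union> u) = V m"
      using m u V(1)[of m] V_eq[OF u] by fastforce
  next
    fix m assume m: "m \<in> Pow {..Suc (Suc n)}"
    define t where "t = m - V m"
    have t: "t \<subseteq> {..Suc (Suc n)}" "t \<inter> V m = {}" "finite t" "V m = V t"
      using m V_eq[of "{}" m] by (auto simp: t_def intro: finite_subset)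
    have V_t: "V t \<subseteq> {..<n}" "V t \<subseteq> {..<Suc n}" "t \<inter> V t = {}"
      using V(1)[of t] t by auto
    have "\<bar>\<Sum>u\<in>Pow (V t). ef p R' (Suc n) (t \<union> u) (T (yv p R n (t \<union> u)))\<bar>
        \<le> 10 * K * (2 powr (1 / 2 - 1 / p)) ^ card (V t) * 2 ^ card (V t)"
    proof (rule fibre_trace_le[OF p(1) V(2) T(1) subspace_Zspace[OF p(1)] T(2)])
      show "upper_l2 p (V t) 10 (\<lambda>u. yv p R n (t \<union> u))"
        by (rule upper_yv[OF p V_t(1) V(4) V_mod V_t(3) t(1)])
      show "(\<Sum>u\<in>Pow (V t). \<bar>ef p R' (Suc n) (t \<union> u) x\<bar>)
          \<le> (2 ^ card (V t)) powr (1 - 1 / p) * lp_norm p x" if "x \<in> lp p" for x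
        using V_mod by (intro sum_abs_ef_le p that V_t t) (auto simp: frozen_def)
    qed (simp_all add: yv_in_Zspace p linear_ef)
    thus "\<bar>\<Sum>u\<in>Pow (V m). ef p R' (Suc n) (m - V m \<union> u) (T (yv p R n (m - V m \<union> u)))\<bar>
        \<le> 10 * K * (2 powr (1 / 2 - 1 / p)) ^ (n div 9) * 2 ^ card (V m)"
      unfolding t(4)[symmetric] unfolding t_def V(3) .
  qed (simp_all add: V)
  moreover have "mean_trace p R R' (Suc n) T - mean_trace p R R' n T
      = (\<Sum>m\<in>Pow {..Suc (Suc n)}. ef p R' (Suc n) m (T (yv p R n m))) / 2 ^ (n + 3)"
    by (rule mean_trace_Suc_diff[OF p(1) T(1)]) (rule T(3))
  moreover have "real (card (Pow {..Suc (Suc n)})) = 2 ^ (n + 3)"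
    by (simp add: card_Pow power_add)
  ultimately show ?thesis
    by (simp only: abs_divide power_abs abs_numeral) (simp only: pos_divide_le_eq zero_less_power zero_less_numeral)
qed

section \<open>Factorization through a separable space\<close>

text \<open>Comparison with the geometric series of the ninth root \<open>r\<close> of
  \<open>q\<close>; rounding costs at most a factor \<open>1 / r ^ 8\<close>.\<close>

lemma summable_power_div:
  fixes q :: real
  assumes "0 < q" "q < 1"
  shows "summable (\<lambda>n. q ^ (n div 9))"
proof -
  define r where "r = root 9 q"
  have r: "0 < r" "r < 1" "r ^ 9 = q"
    using assms by (auto simp: r_def)
  have "q ^ (n div 9) \<le> r ^ n / r ^ 8" for n
  proof -
    have "n \<le> 9 * (n div 9) + 8" by presburger
    hence "r ^ (9 * (n div 9) + 8) \<le> r ^ n"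
      using r by (intro power_decreasing) auto
    thus ?thesis
      using r by (simp add: power_add power_mult pos_le_divide_eq)
  qed
  hence le: "norm (q ^ (n div 9)) \<le> r ^ n / r ^ 8" for n
    using assms(1) by simp
  have "summable (\<lambda>n. r ^ n / r ^ 8)"
    using r(1,2) by (intro summable_divide summable_geometric) simp
  thus ?thesis
    by (rule summable_comparison_test'[where N = 0]) (rule le)
qed

text \<open>As \<open>R' - R\<close> is infinite, arbitrarily many of its bits lie below a large
  \<open>n\<close>, and each further bit contributes a factor less than \<open>1\<close>.\<close>

lemma mean_trace_small_infinitely_often:
  assumes p: "1 \<le> p" "p < 2"
    and R: "\<And>i. i \<in> R' \<Longrightarrow> i mod 9 = 8" "infinite (R' - R)"
    and T: "bounded_on p (Zspace p R) K T" "0 \<le> K"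
    and e: "0 < e"
  obtains n where "N \<le> n" "\<bar>mean_trace p R R' n T\<bar> < e"
proof -
  define q where "q = (2::real) powr (1 / 2 - 1 / p)"
  have q: "0 < q" "q < 1"
    using p by (auto simp: q_def powr_less_one field_simps)
  have "(\<lambda>n. 6 * K * q ^ n) \<longlonglongrightarrow> 6 * K * 0"
    using q by (intro tendsto_mult_left LIMSEQ_power_zero) auto
  hence "eventually (\<lambda>n. 6 * K * q ^ n < e) sequentially"
    using e by (intro order_tendstoD(2)) auto
  then obtain M where M: "6 * K * q ^ M < e"
    using eventually_happens'[OF sequentially_bot] by blast
  obtain B where B: "B \<subseteq> R' - R" "finite B" "card B = M"
    using infinite_arbitrarily_large[OF R(2)] by blast
  \<comment> \<open>\<open>insert 0\<close> keeps \<open>Max\<close> meaningful when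
    \<open>B\<close> is empty.\<close>
  define n where "n = max N (Suc (Max (insert 0 B)))"
  have "B \<subseteq> (R' - R) \<inter> {..<n}"
    using B by (auto simp: n_def less_max_iff_disj less_Suc_eq_le)
  hence "M \<le> card ((R' - R) \<inter> {..<n})"
    using B(3) card_mono[of "(R' - R) \<inter> {..<n}" B] by simp
  hence "6 * K * q ^ card ((R' - R) \<inter> {..<n}) \<le> 6 * K * q ^ M"
    using q T(2) by (intro mult_left_mono power_decreasing) auto
  moreover have "\<bar>mean_trace p R R' n T\<bar> \<le> 6 * K * q ^ card ((R' - R) \<inter> {..<n})"
    unfolding q_def by (rule mean_trace_small[OF p _ T]) (rule R(1))
  ultimately have "\<bar>mean_trace p R R' n T\<bar> < e"
    using M by linarith
  moreover have "N \<le> n"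
    unfolding n_def by (rule max.cobounded1)
  ultimately show ?thesis
    using that by blast
qed

definition factors_through ::
    "real \<Rightarrow> (nat \<Rightarrow> real) set \<Rightarrow> real \<Rightarrow> ((nat \<Rightarrow> real) \<Rightarrow> 'w::real_normed_vector) \<Rightarrow> ('w \<Rightarrow> nat \<Rightarrow> real) \<Rightarrow> bool" where
  "factors_through p Z K S Q \<longleftrightarrow>
     (\<forall>x\<in>Z. \<forall>y\<in>Z. S (x + y) = S x + S y) \<and>
     (\<forall>c. \<forall>x\<in>Z. S (c *\<^sub>R x) = c *\<^sub>R S x) \<and>
     (\<forall>x\<in>Z. norm (S x) \<le> K * lp_norm p x) \<and>
     linear Q \<and> (\<forall>w. Q w \<in> Z \<and> lp_norm p (Q w) \<le> K * norm w) \<and>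
     (\<forall>x\<in>Z. Q (S x) = x)"

text \<open>\<open>Q\<close> is the projection followed by the inverse of the isomorphism. A natural
  number as common bound prepares a pigeonhole argument.\<close>

lemma complemented_subspace_factors_through:
  fixes V :: "'w::real_normed_vector set"
  assumes "complemented_subspace V" "isomorphic_normed Z (lp_norm p) V norm" "subspace Z"
  obtains K :: nat and S and Q :: "'w \<Rightarrow> nat \<Rightarrow> real" where "factors_through p Z K S Q"
proof -
  obtain P where P: "bounded_linear P" "P \<circ> P = P" "range P = V"
    using assms(1) by (auto simp: complemented_subspace_def)
  obtain S C C' where S: "bij_betw S Z V" "\<And>x y. x \<in> Z \<Longrightarrow> y \<in> Z \<Longrightarrow> S (x + y) = S x + S y"
      "\<And>c x. x \<in> Z \<Longrightarrow> S (c *\<^sub>R x) = c *\<^sub>R S x"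
    and C: "\<And>x. x \<in> Z \<Longrightarrow> norm (S x) \<le> C * lp_norm p x" "\<And>x. x \<in> Z \<Longrightarrow> lp_norm p x \<le> C' * norm (S x)"
    using assms(2) unfolding isomorphic_normed_def by metis
  obtain B where B: "B > 0" "\<And>w. norm (P w) \<le> norm w * B"
    using bounded_linear.pos_bounded[OF P(1)] by blast
  define Q where "Q w = inv_into Z S (P w)" for w
  define K where "K = nat \<lceil>max C (\<bar>C'\<bar> * B)\<rceil>"
  have K: "C \<le> real K" "\<bar>C'\<bar> * B \<le> real K"
    unfolding K_def by linarith+
  have inj: "inj_on S Z"
    using S(1) by (simp add: bij_betw_def)
  have Q_Z: "Q w \<in> Z" and S_Q: "S (Q w) = P w" for w
    using S(1) P(3) inv_into_into[of "P w" S Z] f_inv_into_f[of "P w" S Z]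
    by (auto simp: Q_def bij_betw_def)
  have "linear Q"
  proof (rule linearI)
    show "Q (v + w) = Q v + Q w" for v w
      using S(2) Q_Z S_Q inj_onD[OF inj, of "Q (v + w)" "Q v + Q w"] assms(3)
      by (simp add: subspace_add linear_add[OF bounded_linear.linear[OF P(1)]])
    show "Q (c *\<^sub>R w) = c *\<^sub>R Q w" for c w
      using S(3) Q_Z S_Q inj_onD[OF inj, of "Q (c *\<^sub>R w)" "c *\<^sub>R Q w"] assms(3)
      by (simp add: subspace_scale linear_scale[OF bounded_linear.linear[OF P(1)]])
  qed
  moreover have "norm (S x) \<le> real K * lp_norm p x" if "x \<in> Z" for x
    using C(1)[OF that] mult_right_mono[OF K(1), of "lp_norm p x"] by simp
  moreover have "lp_norm p (Q w) \<le> real K * norm w" for w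
  proof -
    have "lp_norm p (Q w) \<le> C' * norm (P w)"
      using C(2)[OF Q_Z, of w] by (simp add: S_Q)
    also have "\<dots> \<le> \<bar>C'\<bar> * (norm w * B)"
      using B(2)[of w] by (intro mult_mono) auto
    also have "\<dots> \<le> real K * norm w"
      using mult_right_mono[OF K(2), of "norm w"] by (simp add: mult_ac)
    finally show ?thesis .
  qed
  moreover have "Q (S x) = x" if "x \<in> Z" for x
  proof -
    have "S x \<in> range P"
      using that S(1) P(3) by (auto simp: bij_betw_def)
    hence "P (S x) = S x"
      using P(2) by (metis (no_types, lifting) comp_apply imageE)
    thus ?thesis
      using that inj by (simp add: Q_def)
  qed
  ultimately have "factors_through p Z (real K) S Q"
    using S(2,3) Q_Z by (simp add: factors_through_def)
  thus ?thesis by (rule that)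
qed

text \<open>Lower Dedekind cuts form an uncountable chain with infinite differences; the positions
  \<open>9 * k + 8\<close> stay clear of all colours.\<close>

definition digits :: "real \<Rightarrow> nat set" where
  "digits x = (\<lambda>q::rat. 9 * to_nat q + 8) ` {q. of_rat q < x}"

lemma digits_mod: "i \<in> digits x \<Longrightarrow> i mod 9 = 8"
  by (auto simp: digits_def)

lemma infinite_digits_diff:
  assumes "x < y"
  shows "infinite (digits y - digits x)"
proof -
  obtain a where a: "x < of_rat a" "of_rat a < y"
    using of_rat_dense[OF assms] by blast
  obtain b where b: "of_rat a < (of_rat b :: real)" "of_rat b < y"
    using of_rat_dense[OF a(2)] by blast
  let ?f = "\<lambda>q::rat. 9 * to_nat q + 8"
  have inj: "inj ?f"
    by (auto intro!: injI)
  have "?f ` {a<..<b} \<subseteq> digits y - digits x"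
  proof (rule image_subsetI)
    fix q assume "q \<in> {a<..<b}"
    hence "of_rat a < (of_rat q :: real)" "of_rat q < (of_rat b :: real)"
      by (auto simp: of_rat_less)
    thus "?f q \<in> digits y - digits x"
      using a b by (auto simp: digits_def)
  qed
  moreover have "infinite (?f ` {a<..<b})"
    using b(1) by (subst finite_image_iff) (auto simp: of_rat_less infinite_Ioo intro: inj_on_subset[OF inj])
  ultimately show ?thesis
    using finite_subset by blast
qed

text \<open>Approximating each \<open>F x j\<close> by a point of \<open>D\<close> gives only
  countably many patterns on the finite \<open>J\<close>, so two elements of \<open>X\<close> share
  one.\<close>

lemma separable_uncountable_close_pair:
  fixes F :: "real \<Rightarrow> 'j \<Rightarrow> 'w::metric_space" and D :: "'w set"
  assumes D: "countable D" "closure D = UNIV" and J: "finite J" and X: "uncountable X" and e: "0 < e"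
  obtains x y where "x \<in> X" "y \<in> X" "x < y" "\<forall>j\<in>J. dist (F x j) (F y j) < e"
proof -
  define g where "g x j = (SOME d. d \<in> D \<and> dist d (F x j) < e / 2)" for x j
  have "\<exists>d. d \<in> D \<and> dist d (F x j) < e / 2" for x j
    using D(2) half_gt_zero[OF e] closure_approachable[of "F x j" D] by blast
  from someI_ex[OF this] have g: "g x j \<in> D" "dist (g x j) (F x j) < e / 2" for x j
    by (simp_all add: g_def)
  define h where "h x = restrict (g x) J" for x
  have "h ` X \<subseteq> (\<Pi>\<^sub>E j\<in>J. D)"
    using g(1) by (auto simp: h_def)
  moreover have "countable (\<Pi>\<^sub>E j\<in>J. D)"
    by (rule countable_PiE[OF J]) (rule D(1))
  ultimately have "countable (h ` X)"
    by (rule countable_subset)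
  hence "\<not> inj_on h X"
    using X countable_image_inj_on by blast
  then obtain x y where xy: "x \<in> X" "y \<in> X" "x \<noteq> y" "h x = h y"
    by (auto simp: inj_on_def)
  have close: "dist (F x j) (F y j) < e" if "j \<in> J" for j
  proof -
    have "g x j = g y j"
      using fun_cong[OF xy(4), of j] that by (simp add: h_def)
    thus ?thesis
      using dist_triangle_half_r[of "g x j" "F x j" e "F y j"] g(2)[of x j] g(2)[of y j] by simp
  qed
  hence close': "dist (F y j) (F x j) < e" if "j \<in> J" for j
    using that by (simp add: dist_commute)
  from xy(3) consider "x < y" | "y < x" by linarith
  thus ?thesis
    using xy(1,2) close close' that by cases blast+
qed

lemma bounded_on_factors_through:
  assumes "factors_through p Z K S Q" "factors_through p Z' K S' Q'" "Z' \<subseteq> lp p" "0 \<le> K"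
  shows "bounded_on p Z (K * K) (\<lambda>x. Q' (S x))"
  unfolding bounded_on_def
proof (intro conjI ballI allI)
  have Q': "linear Q'"
    using assms(2) by (simp add: factors_through_def)
  show "Q' (S (x + y)) = Q' (S x) + Q' (S y)" if "x \<in> Z" "y \<in> Z" for x y
    using assms(1) that by (simp add: factors_through_def linear_add[OF Q'])
  show "Q' (S (c *\<^sub>R x)) = c *\<^sub>R Q' (S x)" if "x \<in> Z" for c x
    using assms(1) that by (simp add: factors_through_def linear_scale[OF Q'])
  show "Q' (S x) \<in> lp p" for x
    using assms(2,3) by (auto simp: factors_through_def)
  show "lp_norm p (Q' (S x)) \<le> K * K * lp_norm p x" if "x \<in> Z" for x
  proof -
    have "lp_norm p (Q' (S x)) \<le> K * norm (S x)"
      using assms(2) by (simp add: factors_through_def)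
    also have "\<dots> \<le> K * (K * lp_norm p x)"
      using assms(1,4) that by (intro mult_left_mono) (auto simp: factors_through_def)
    finally show ?thesis by (simp add: mult.assoc)
  qed
qed

text \<open>\<open>Q'\<close> maps \<open>S' (zv p R' N s)\<close> back to
  \<open>zv p R' N s\<close>, so each diagonal entry is \<open>1\<close> plus an error controlled by
  the distance of the two images.\<close>

lemma mean_trace_near_one:
  assumes p: "1 \<le> p"
    and f: "factors_through p (Zspace p R) K S Q" "factors_through p (Zspace p R') K S' Q'" "0 \<le> K"
    and close: "\<And>s. s \<subseteq> {..N} \<Longrightarrow> K * norm (S (zv p R N s) - S' (zv p R' N s)) \<le> 1 / 4"
  shows "mean_trace p R R' N (\<lambda>x. Q' (S x)) \<ge> 3 / 4"
proof -
  have Q': "linear Q'"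
    using f(2) by (simp add: factors_through_def)
  have "3 / 4 \<le> zf p R' N s (Q' (S (zv p R N s)))" if "s \<in> Pow {..N}" for s
  proof -
    let ?w = "S (zv p R N s) - S' (zv p R' N s)"
    have s: "s \<subseteq> {..N}" using that by simp
    have "Q' (S' (zv p R' N s)) = zv p R' N s"
      using f(2) zv_in_Zspace[OF p s] by (simp add: factors_through_def)
    hence "Q' (S (zv p R N s)) = zv p R' N s + Q' ?w"
      by (simp add: linear_diff[OF Q'])
    hence "zf p R' N s (Q' (S (zv p R N s))) = 1 + zf p R' N s (Q' ?w)"
      by (simp add: linear_add[OF linear_zf] zf_zv[OF p s s])
    moreover have "\<bar>zf p R' N s (Q' ?w)\<bar> \<le> lp_norm p (Q' ?w)"
      using f(2) by (intro abs_zf_le p subsetD[OF Zspace_subset_lp[of p R']]) (simp add: factors_through_def)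
    moreover have "lp_norm p (Q' ?w) \<le> K * norm ?w"
      using f(2) by (simp add: factors_through_def)
    ultimately show ?thesis
      using close[OF s] by linarith
  qed
  hence "(\<Sum>s\<in>Pow {..N}. 3 / 4) \<le> (\<Sum>s\<in>Pow {..N}. zf p R' N s (Q' (S (zv p R N s))))"
    by (rule sum_mono)
  thus ?thesis
    by (simp add: mean_trace_def card_Pow field_simps)
qed

theorem corollary19:
  fixes p :: real
  assumes "1 \<le> p" and "p < 2"
  shows "\<not> (separable_space (euclidean :: 'w::banach topology) \<and>
            complementably_universal TYPE('w) (closed_subspaces_lp p))"
proof
  assume asm: "separable_space (euclidean :: 'w topology) \<and>
    complementably_universal TYPE('w) (closed_subspaces_lp p)"
  note p = assms
  obtain D :: "'w set" where D: "countable D" "closure D = UNIV"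
    using asm by (auto simp: separable_space_def)
  have "\<exists>(K::nat) S (Q :: 'w \<Rightarrow> _). factors_through p (Zspace p (digits x)) K S Q" for x
  proof -
    have "(Zspace p (digits x), lp_norm p) \<in> closed_subspaces_lp p"
      using subspace_Zspace closedin_Zspace p(1) by (auto simp: closed_subspaces_lp_def)
    then obtain V :: "'w set" where
      V: "complemented_subspace V" "isomorphic_normed (Zspace p (digits x)) (lp_norm p) V norm"
      using asm by (fastforce simp: complementably_universal_def)
    obtain K :: nat and S and Q :: "'w \<Rightarrow> nat \<Rightarrow> real"
      where "factors_through p (Zspace p (digits x)) K S Q"
      by (rule complemented_subspace_factors_through[OF V subspace_Zspace[OF p(1)]])
    thus ?thesis by blast
  qed
  then obtain k :: "real \<Rightarrow> nat" and S and Q :: "real \<Rightarrow> 'w \<Rightarrow> nat \<Rightarrow> real"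
    where SQ: "\<And>x. factors_through p (Zspace p (digits x)) (k x) (S x) (Q x)"
    by metis
  \<comment> \<open>Pigeonhole: uncountably many reals share one of the countably many
    bounds.\<close>
  have "\<exists>K. uncountable {x. k x = K}"
  proof (rule ccontr)
    assume "\<not> ?thesis"
    hence "countable (\<Union>K. {x. k x = K})"
      by (intro countable_UN) auto
    moreover have "(\<Union>K. {x. k x = K}) = UNIV" by blast
    ultimately show False
      using uncountable_UNIV_real by simp
  qed
  then obtain K where K: "uncountable {x. k x = K}" by blast
  define q where "q = (2::real) powr (1 / 2 - 1 / p)"
  have q: "0 < q" "q < 1"
    using p by (auto simp: q_def powr_less_one field_simps)
  have "summable (\<lambda>n. 10 * (real K * real K) * q ^ (n div 9))"
    by (intro summable_mult summable_power_div q)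
  \<comment> \<open>\<open>N\<close> depends only on \<open>K\<close> and \<open>p\<close>, so it is
    fixed before \<open>x\<close> and \<open>y\<close>, and only finitely many images at level
    \<open>N\<close> have to be matched.\<close>
  hence "\<exists>N. \<forall>m\<ge>N. \<forall>n. norm (\<Sum>i=m..<n. 10 * (real K * real K) * q ^ (i div 9)) < 1 / 4"
    unfolding summable_Cauchy by (elim allE[where x = "1 / 4"]) simp
  then obtain N where N: "\<And>n. \<bar>\<Sum>i=N..<n. 10 * (real K * real K) * q ^ (i div 9)\<bar> < 1 / 4"
    by (metis order_refl real_norm_def)
  \<comment> \<open>The tolerance stays below \<open>1 / 4\<close> after multiplication by
    \<open>K\<close>; \<open>K + 1\<close> avoids a zero denominator.\<close>
  have fin: "finite (Pow {..N})" and pos: "0 < 1 / (4 * (real K + 1))"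
    by simp_all
  obtain x y where "x \<in> {x. k x = K}" "y \<in> {x. k x = K}" "x < y"
    and close: "\<forall>s\<in>Pow {..N}.
      dist (S x (zv p (digits x) N s)) (S y (zv p (digits y) N s)) < 1 / (4 * (real K + 1))"
    by (rule separable_uncountable_close_pair[OF D fin K pos, where F = "\<lambda>x s. S x (zv p (digits x) N s)"])
  hence xy: "k x = K" "k y = K" "x < y"
    by simp_all
  define T where "T v = Q y (S x v)" for v
  note fx = SQ[of x, unfolded xy(1)] and fy = SQ[of y, unfolded xy(2)]
  have T: "bounded_on p (Zspace p (digits x)) (real K * real K) T"
    unfolding T_def by (rule bounded_on_factors_through[OF fx fy Zspace_subset_lp]) simp
  have T_Z: "T v \<in> Zspace p (digits y)" for v
    using fy by (simp add: T_def factors_through_def)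
  let ?tr = "\<lambda>n. mean_trace p (digits x) (digits y) n T"
  have "?tr N \<ge> 3 / 4"
    unfolding T_def
  proof (rule mean_trace_near_one[OF p(1) fx fy])
    fix s assume "s \<subseteq> {..N}"
    hence "norm (S x (zv p (digits x) N s) - S y (zv p (digits y) N s)) \<le> 1 / (4 * (real K + 1))"
      using bspec[OF close, of s] by (simp add: dist_norm)
    hence "real K * norm (S x (zv p (digits x) N s) - S y (zv p (digits y) N s))
        \<le> real K * (1 / (4 * (real K + 1)))"
      by (rule mult_left_mono) simp
    also have "\<dots> \<le> 1 / 4" by (simp add: field_simps)
    finally show "real K * norm (S x (zv p (digits x) N s) - S y (zv p (digits y) N s)) \<le> 1 / 4" .
  qed simp
  moreover obtain n where n: "N \<le> n" "\<bar>?tr n\<bar> < 1 / 4"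
    by (rule mean_trace_small_infinitely_often[OF p digits_mod infinite_digits_diff[OF xy(3)] T, where e = "1 / 4" and N = N])
      simp_all
  moreover have "\<bar>?tr n - ?tr N\<bar> < 1 / 4"
  proof -
    have "?tr n - ?tr N = (\<Sum>i=N..<n. ?tr (Suc i) - ?tr i)"
      by (rule sum_Suc_diff'[OF n(1), of ?tr, symmetric])
    moreover have "\<bar>\<Sum>i=N..<n. ?tr (Suc i) - ?tr i\<bar> \<le> (\<Sum>i=N..<n. 10 * (real K * real K) * q ^ (i div 9))"
      unfolding q_def
    proof (rule order.trans[OF sum_abs], rule sum_mono)
      show "\<bar>?tr (Suc i) - ?tr i\<bar> \<le> 10 * (real K * real K) * (2 powr (1 / 2 - 1 / p)) ^ (i div 9)" for i
        by (rule mean_trace_Suc_diff_le[OF p _ T]) (simp_all add: digits_mod T_Z)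
    qed
    ultimately show ?thesis
      using N[of n] by linarith
  qed
  \<comment> \<open>The trace at level \<open>n\<close> would exceed \<open>3 / 4 - 1 / 4\<close>
    and yet be below \<open>1 / 4\<close>.\<close>
  ultimately show False by linarith
qed

unused_thms Defs -

end
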